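(* Let $T$ be a weak-type $(1,1)$ bounded operator on $\mathbb{R}^d$ such that $$Tf(x)=\int_{\mathbb{R}^d}K(x,y)f(y)\,\mathrm{d}y\qquad\text{for all }x\notin\operatorname{supp}f$$ for all compactly supported $f\in L^1(\mathbb{R}^d)$, where the kernel $K$ satisfies $$|K(x,y)-K(z,y)|\leq\Omega\Bigl(\frac{|x-z|}{|x-y|}\Bigr)\frac{1}{|x-y|^d}$$ for all $x,y,z$ with $|x-y|>2|x-z|>0$, and where $\Omega:[0,\infty)\to[0,\infty)$ is an increasing subadditive function with $\Omega(0)=0$. Let $w$ be a weight with $w^{-1}\in L^1_{\mathrm{loc}}(\mathbb{R}^d)$. Then for all compactly supported functions $f$ with $fw\in L^\infty(\mathbb{R}^d)$ and all cubes $Q$, $$\frac{1}{|Q|}\int_Q|Tf-\langle Tf\rangle_Q|\,\mathrm{d}x\leq C\bigl([1]_{B(\Omega)}+[w^{-1}]_{B(\Omega)}\bigr)[w^{-1}]_{A_\infty}\langle w^{-1}\rangle_Q\|fw\|_{L^\infty(\mathbb{R}^d)}$$ and $$\|w\|_{L^\infty(Q)}\frac{1}{|Q|}\int_Q|Tf-\langle Tf\rangle_Q|\,\mathrm{d}x\leq C\,[w^{-1}]_{A_1}^2[w^{-1}]_{A_\infty}\|\Omega\|_{\mathrm{Dini}}\|fw\|_{L^\infty(\mathbb{R}^d)},$$ where the constant $C>0$ depends only on $d$ and the operator $T$ (together with its kernel data $K,\Omega$), and is independent of $w$, $f$ and $Q$.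
   Context: A cube is a half-open cube with sides parallel to the coordinate axes; $c_Q$ is its center and $\ell(Q)$ its side length. A weight is a measurable function $w$ with $0<w<\infty$ a.e.; $w(E)=\int_E w\,\mathrm{d}x$. We write $\langle g\rangle_Q=\frac1{|Q|}\int_Q g\,\mathrm{d}x$. The maximal operator is $Mf=\sup_Q\big(\frac1{|Q|}\int_Q|f|\,\mathrm{d}x\big)\mathbf 1_Q$, the supremum over all cubes. For a weight $v$ (all suprema over all cubes in $\mathbb{R}^d$; constants may be infinite): $$[v]_{A_1}=\sup_Q\langle v\rangle_Q\|v^{-1}\|_{L^\infty(Q)},\qquad [v]_{A_\infty}=\sup_Q\frac1{v(Q)}\int_Q M(\mathbf 1_Qv)\,\mathrm{d}x,$$ $$[v]_{B(\Omega)}=\sup_Q\frac{|Q|}{v(Q)}\int_{Q^c}\frac{v(x)}{|x-c_Q|^d}\,\Omega\Bigl(\frac{\ell(Q)}{|x-c_Q|}\Bigr)\mathrm{d}x,$$ and $[1]_{B(\Omega)}$ is this quantity for the constant weight $1$. Moreover $\|\Omega\|_{\mathrm{Dini}}=\int_0^1\Omega(t)\,\frac{\mathrm{d}t}{t}$.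
   Formalization: The operator T is assumed linear, and "increasing" for Ω is read as nondecreasing and not identically zero; without linearity, or with Ω = 0 (T the identity, K = 0), the stated inequalities fail. *)

theory Defs
  imports "HOL-Analysis.Analysis" "HOL-Probability.Essential_Supremum"
begin

text \<open>
  All quantities that may be infinite are \<^typ>\<open>ennreal\<close>-valued, and measurability is always
  Lebesgue measurability.  A half-open cube is given by its centre \<open>c\<close> and its side length
  \<open>l > 0\<close>.
\<close>

definition cube :: "real ^ 'd \<Rightarrow> real \<Rightarrow> (real ^ 'd) set" where
  "cube c l = {x. \<forall>i. c $ i - l / 2 \<le> x $ i \<and> x $ i < c $ i + l / 2}"

definition weight :: "(real ^ 'd \<Rightarrow> real) \<Rightarrow> bool" where
  "weight w \<longleftrightarrow> w \<in> borel_measurable lebesgue \<and> (AE x in lebesgue. 0 < w x)"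

definition weight_measure :: "(real ^ 'd \<Rightarrow> real) \<Rightarrow> (real ^ 'd) set \<Rightarrow> ennreal" where
  "weight_measure v E = (\<integral>\<^sup>+x\<in>E. ennreal (v x) \<partial>lebesgue)"

definition weight_avg :: "(real ^ 'd \<Rightarrow> real) \<Rightarrow> (real ^ 'd) set \<Rightarrow> ennreal" where
  "weight_avg v Q = weight_measure v Q / emeasure lebesgue Q"

definition Linf_norm :: "(real ^ 'd) set \<Rightarrow> (real ^ 'd \<Rightarrow> 'a::real_normed_vector) \<Rightarrow> ennreal" where
  "Linf_norm E g = esssup (lebesgue_on E) (\<lambda>x. ennreal (norm (g x)))"

definition avg :: "(real ^ 'd \<Rightarrow> complex) \<Rightarrow> (real ^ 'd) set \<Rightarrow> complex" where
  "avg g Q = (LINT x:Q|lebesgue. g x) /\<^sub>R measure lebesgue Q"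

text \<open>
  If \<open>g\<close> is measurable but not integrable on the cube \<open>Q\<close>, then \<^term>\<open>avg g Q = 0\<close> and the
  following quantity is \<open>\<infinity>\<close>.  A finite bound for it thus includes integrability of \<open>g\<close> on \<open>Q\<close>.
\<close>

definition mean_osc :: "(real ^ 'd \<Rightarrow> complex) \<Rightarrow> (real ^ 'd) set \<Rightarrow> ennreal" where
  "mean_osc g Q = (\<integral>\<^sup>+x\<in>Q. ennreal (norm (g x - avg g Q)) \<partial>lebesgue) / emeasure lebesgue Q"

definition maximal_op :: "(real ^ 'd \<Rightarrow> real) \<Rightarrow> real ^ 'd \<Rightarrow> ennreal" where
  "maximal_op f x =
     (SUP c. SUP l\<in>{0<..}.
        (\<integral>\<^sup>+y\<in>cube c l. ennreal \<bar>f y\<bar> \<partial>lebesgue) / emeasure lebesgue (cube c l)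
          * indicator (cube c l) x)"

definition A1_const :: "(real ^ 'd \<Rightarrow> real) \<Rightarrow> ennreal" where
  "A1_const v =
     (SUP c. SUP l\<in>{0<..}. weight_avg v (cube c l) * Linf_norm (cube c l) (\<lambda>x. inverse (v x)))"

definition Ainf_const :: "(real ^ 'd \<Rightarrow> real) \<Rightarrow> ennreal" where
  "Ainf_const v =
     (SUP c. SUP l\<in>{0<..}.
        (\<integral>\<^sup>+x\<in>cube c l. maximal_op (\<lambda>y. indicat_real (cube c l) y * v y) x \<partial>lebesgue)
          / weight_measure v (cube c l))"

definition B_const :: "(real \<Rightarrow> real) \<Rightarrow> (real ^ 'd \<Rightarrow> real) \<Rightarrow> ennreal" where
  "B_const \<Omega> v =
     (SUP c. SUP l\<in>{0<..}.
        emeasure lebesgue (cube c l) / weight_measure v (cube c l)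
          * (\<integral>\<^sup>+x\<in>- cube c l.
               ennreal (v x / norm (x - c) ^ CARD('d) * \<Omega> (l / norm (x - c))) \<partial>lebesgue))"

definition Dini_norm :: "(real \<Rightarrow> real) \<Rightarrow> ennreal" where
  "Dini_norm \<Omega> = (\<integral>\<^sup>+t\<in>{0<..<1}. ennreal (\<Omega> t / t) \<partial>lebesgue)"

text \<open>
  The support of (the class of) a measurable function: the complement of the largest open set
  on which the function vanishes almost everywhere.
\<close>

definition ess_support :: "(real ^ 'd \<Rightarrow> complex) \<Rightarrow> (real ^ 'd) set" where
  "ess_support f = - \<Union>{U. open U \<and> (AE x in lebesgue. x \<in> U \<longrightarrow> f x = 0)}"

text \<open>
  An operator on \<open>L\<^sup>1\<close> is a map on functions of which only the values at integrable functions, up to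
  null sets, matter.  Linearity and the weak-type bound together make \<open>T f\<close> depend, up to
  null sets, only on the almost-everywhere class of \<open>f\<close>.
\<close>

definition linear_on_L1 ::
  "((real ^ 'd \<Rightarrow> complex) \<Rightarrow> real ^ 'd \<Rightarrow> complex) \<Rightarrow> bool" where
  "linear_on_L1 T \<longleftrightarrow>
     (\<forall>f g. integrable lebesgue f \<longrightarrow> integrable lebesgue g \<longrightarrow>
        (AE x in lebesgue. T (\<lambda>y. f y + g y) x = T f x + T g x)) \<and>
     (\<forall>a f. integrable lebesgue f \<longrightarrow>
        (AE x in lebesgue. T (\<lambda>y. a * f y) x = a * T f x))"

definition weak_type_1_1 ::
  "((real ^ 'd \<Rightarrow> complex) \<Rightarrow> real ^ 'd \<Rightarrow> complex) \<Rightarrow> bool" where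
  "weak_type_1_1 T \<longleftrightarrow>
     (\<exists>N\<ge>0. \<forall>f. integrable lebesgue f \<longrightarrow>
        T f \<in> borel_measurable lebesgue \<and>
        (\<forall>t>0. ennreal t * emeasure lebesgue {x. t < norm (T f x)}
           \<le> ennreal (N * (\<integral>x. norm (f x) \<partial>lebesgue))))"

text \<open>
  The kernel integral has to exist at every point off the support; it equals \<open>T f\<close> there up
  to a null set, since \<open>T f\<close> is only determined up to null sets.
\<close>

definition has_kernel ::
  "((real ^ 'd \<Rightarrow> complex) \<Rightarrow> real ^ 'd \<Rightarrow> complex) \<Rightarrow> (real ^ 'd \<Rightarrow> real ^ 'd \<Rightarrow> complex) \<Rightarrow> bool"
where
  "has_kernel T K \<longleftrightarrow>
     (\<forall>f. integrable lebesgue f \<longrightarrow> compact (ess_support f) \<longrightarrow>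
        (\<forall>x. x \<notin> ess_support f \<longrightarrow> integrable lebesgue (\<lambda>y. K x y * f y)) \<and>
        (AE x in lebesgue. x \<notin> ess_support f \<longrightarrow> T f x = (\<integral>y. K x y * f y \<partial>lebesgue)))"

end

theory Submission
  imports Defs
begin

text \<open>
  Put \<open>v = w\<^sup>-\<^sup>1\<close> and \<open>L = \<parallel>f w\<parallel>\<^sub>\<infinity>\<close>, so that \<open>|f| \<le> L v\<close>.  The proof splits into a local estimate for \<open>T\<close> and a
  covering argument that has nothing to do with \<open>T\<close>.

  The local estimate (\<open>local_oscillation_singular_integral\<close>): for each cube \<open>Q\<close> there is a number \<open>m\<close>
  such that \<open>|T f - m| \<le> a \<langle>v\<rangle>\<^sub>Q\<close> on \<open>Q\<close> outside a set of measure at most \<open>2\<^sup>-\<^sup>d\<^sup>-\<^sup>2 |Q|\<close>, where \<open>a\<close> is a multiple of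
  \<open>L ([1]\<^sub>B + [v]\<^sub>B)\<close>.  The part of \<open>f\<close> off a fixed dilate of \<open>Q\<close> is handled by the smoothness of the
  kernel and the tail integral in the definition of \<open>[v]\<^sub>B\<close>, the part on the dilate by the weak-type
  bound.  The latter needs that \<open>v\<close> is doubling, which is again contained in the tail condition: a
  nonzero increasing subadditive function is positive on the positive axis, so the tail integral
  over the dilate minus \<open>Q\<close> dominates the mass of \<open>v\<close> there.

  The covering argument (\<open>oscillation_le_maximal_op\<close>): from such a weak local estimate on all cubes
  follows \<open>\<integral>\<^sub>Q |T f - m| \<le> 4 a \<integral>\<^sub>Q M(1\<^sub>Q v)\<close>, and the right-hand side is at most \<open>4 a [v] v(Q)\<close> with the
  \<open>A\<^sub>\<infinity>\<close> constant \<open>[v]\<close>.  The exceptional set of \<open>Q\<close> is covered up to a null set by disjoint dyadic cubes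
  \<open>Q'\<close> that fill at most half of \<open>Q\<close> and are at most half filled by it
  (\<open>calderon_zygmund_covering\<close>).  So the constants of \<open>Q\<close> and \<open>Q'\<close> differ by at most
  \<open>a \<langle>v\<rangle>\<^sub>Q + a \<langle>v\<rangle>\<^sub>Q\<^sub>'\<close>, and the argument can be repeated in each \<open>Q'\<close>.  The errors sum up because
  \<open>v(Q) \<le> 2 \<langle>v\<rangle>\<^sub>Q |Q - \<Union>Q'|\<close> is bounded by twice the integral of \<open>M(1\<^sub>Q v)\<close> over the part of \<open>Q\<close> that is not
  covered, and these parts are disjoint over all generations.

  For the second inequality, \<open>B_const_le_Dini\<close> decomposes the tail into dyadic annuli and bounds
  \<open>[v]\<^sub>B\<close> by the \<open>A\<^sub>1\<close> constant times the Dini norm; its second power arises because the product of \<open>\<langle>v\<rangle>\<^sub>Q\<close> and the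
  norm of \<open>w\<close> in \<open>L\<^sup>\<infinity>(Q)\<close> is at most the \<open>A\<^sub>1\<close> constant of \<open>v\<close>.
\<close>

section \<open>Cubes\<close>

lemma box_subset_cube: "box (\<chi> i. c $ i - l / 2) (\<chi> i. c $ i + l / 2) \<subseteq> cube c l"
  and cube_subset_cbox: "cube c l \<subseteq> cbox (\<chi> i. c $ i - l / 2) (\<chi> i. c $ i + l / 2)"
  by (auto simp: cube_def mem_box_cart less_imp_le)

lemma cube_borel [measurable]: "cube c l \<in> sets borel"
proof -
  have "cube c l = (\<Inter>i. {x. c $ i - l / 2 \<le> x $ i} \<inter> {x. x $ i < c $ i + l / 2})"
    by (auto simp: cube_def)
  moreover have "closed {x::real^'a. c $ i - l / 2 \<le> x $ i}" "open {x::real^'a. x $ i < c $ i + l / 2}" for i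
    by (auto intro!: closed_Collect_le open_Collect_less continuous_intros)
  ultimately show ?thesis
    by (auto intro!: sets.Int)
qed

lemma cube_lebesgue [measurable, simp]: "cube c l \<in> sets lebesgue"
  using cube_borel by (simp add: sets_completionI_sets)

lemma emeasure_cube:
  fixes c :: "real ^ 'd"
  assumes "l > 0"
  shows "emeasure lebesgue (cube c l) = ennreal (l ^ CARD('d))"
proof -
  let ?a = "(\<chi> i. c $ i - l / 2) :: real^'d" and ?b = "(\<chi> i. c $ i + l / 2) :: real^'d"
  have *: "(?b - ?a) \<bullet> b = l" if "b \<in> Basis" for b
    using that by (auto simp: Basis_vec_def inner_axis)
  then have le: "?a \<bullet> b \<le> ?b \<bullet> b" if "b \<in> Basis" for b
    using that assms by (metis inner_diff_left less_eq_real_def diff_ge_0_iff_ge)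
  have "emeasure lborel (box ?a ?b) = ennreal (l ^ CARD('d))"
    by (subst emeasure_lborel_box[OF le]) (auto simp only: * prod_constant DIM_cart DIM_real mult_1_right cong: prod.cong)
  moreover have "emeasure lborel (cbox ?a ?b) = ennreal (l ^ CARD('d))"
    by (subst emeasure_lborel_cbox[OF le]) (auto simp only: * prod_constant DIM_cart DIM_real mult_1_right cong: prod.cong)
  ultimately show ?thesis
    using emeasure_mono[OF box_subset_cube[of c l], of lebesgue]
      emeasure_mono[OF cube_subset_cbox[of c l], of lebesgue]
    by (auto intro: sets_completionI_sets)
qed

lemma emeasure_cube_pos: "l > 0 \<Longrightarrow> emeasure lebesgue (cube c l) > 0"
  and emeasure_cube_nz: "l > 0 \<Longrightarrow> emeasure lebesgue (cube c l) \<noteq> 0"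
  and emeasure_cube_fin: "l > 0 \<Longrightarrow> emeasure lebesgue (cube c l) < \<infinity>"
  and emeasure_cube_nt: "l > 0 \<Longrightarrow> emeasure lebesgue (cube c l) \<noteq> top"
  by (simp_all only: emeasure_cube, auto)

lemma centre_in_cube: "l > 0 \<Longrightarrow> c \<in> cube c l"
  by (simp add: cube_def)

lemma cube_mono: "l \<le> l' \<Longrightarrow> cube c l \<subseteq> cube c l'"
  by (auto simp: cube_def) (smt (verit) field_sum_of_halves)+

lemma norm_le_in_cube:
  fixes c :: "real ^ 'd" and l :: real
  assumes "x \<in> cube c l"
  shows "norm (x - c) \<le> CARD('d) * l / 2"
proof -
  have "norm (x - c) \<le> (\<Sum>i\<in>UNIV. \<bar>(x - c) $ i\<bar>)" by (rule norm_le_l1_cart)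
  also have "\<dots> \<le> (\<Sum>i\<in>(UNIV::'d set). l / 2)"
  proof (rule sum_mono)
    fix i
    have "c $ i - l / 2 \<le> x $ i" "x $ i < c $ i + l / 2" using assms by (auto simp: cube_def)
    then show "\<bar>(x - c) $ i\<bar> \<le> l / 2" unfolding vector_minus_component by linarith
  qed
  finally show ?thesis by simp
qed

lemma norm_ge_off_cube:
  fixes c :: "real ^ 'd"
  assumes "x \<notin> cube c l"
  shows "l / 2 \<le> norm (x - c)"
proof -
  obtain i where "x $ i < c $ i - l / 2 \<or> x $ i \<ge> c $ i + l / 2"
    using assms by (auto simp: cube_def not_le not_less)
  then have "l / 2 \<le> \<bar>(x - c) $ i\<bar>" by (auto simp: abs_if)
  then show ?thesis using component_le_norm_cart[of "x - c" i] by linarith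
qed

section \<open>Dyadic subcubes and stopping\<close>

text \<open>
  The centre of the cube containing \<open>x\<close> in the \<open>n\<close>-th dyadic refinement of \<^term>\<open>cube c l\<close>.  The grid is
  continued to all of space, so \<open>x\<close> need not lie in \<^term>\<open>cube c l\<close>.  Two points lie in the same cube
  exactly if the centres agree, which turns all questions about dyadic cubes into equations.
\<close>

definition dyadic_centre :: "real ^ 'd \<Rightarrow> real \<Rightarrow> nat \<Rightarrow> real ^ 'd \<Rightarrow> real ^ 'd" where
  "dyadic_centre c l n x =
     (\<chi> i. c $ i - l / 2 + (real_of_int \<lfloor>2 ^ n * ((x $ i - (c $ i - l / 2)) / l)\<rfloor> + 1 / 2) * (l / 2 ^ n))"

lemma dyadic_centre_eq_iff:
  assumes "l > 0"
  shows "dyadic_centre c l n y = dyadic_centre c l n x \<longleftrightarrow>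
    (\<forall>i. \<lfloor>2 ^ n * ((y $ i - (c $ i - l / 2)) / l)\<rfloor> = \<lfloor>2 ^ n * ((x $ i - (c $ i - l / 2)) / l)\<rfloor>)"
  using assms by (auto simp: dyadic_centre_def vec_eq_iff)

lemma mem_dyadic_cube:
  assumes "l > 0"
  shows "y \<in> cube (dyadic_centre c l n x) (l / 2 ^ n) \<longleftrightarrow> dyadic_centre c l n y = dyadic_centre c l n x"
proof -
  have "(a + (real_of_int k + 1 / 2) * (l / 2 ^ n) - l / 2 ^ n / 2 \<le> z \<and>
         z < a + (real_of_int k + 1 / 2) * (l / 2 ^ n) + l / 2 ^ n / 2)
     \<longleftrightarrow> \<lfloor>2 ^ n * ((z - a) / l)\<rfloor> = k" for a z k
  proof -
    define h where "h = l / 2 ^ n"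
    have "h > 0" "2 ^ n * ((z - a) / l) = (z - a) / h" using assms by (auto simp: h_def)
    then show ?thesis
      unfolding floor_eq_iff h_def[symmetric]
      by (simp add: pos_le_divide_eq pos_divide_less_eq algebra_simps)
  qed
  then show ?thesis
    unfolding dyadic_centre_eq_iff[OF assms] unfolding cube_def dyadic_centre_def by simp
qed

text \<open>
  Nestedness: the coarser floor is the finer floor divided by a power of two.
\<close>

lemma dyadic_centre_antimono:
  assumes "l > 0" "m \<le> n" "dyadic_centre c l n y = dyadic_centre c l n x"
  shows "dyadic_centre c l m y = dyadic_centre c l m x"
proof -
  have *: "\<lfloor>2 ^ m * z\<rfloor> = \<lfloor>2 ^ n * z\<rfloor> div 2 ^ (n - m)" for z :: real
  proof -
    have "2 ^ m * z = (2 ^ n * z) / real_of_int (2 ^ (n - m))"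
      using assms by (simp add: field_simps flip: power_add)
    then show ?thesis by (simp add: floor_divide_real_eq_div del: of_int_power)
  qed
  show ?thesis
    using assms(3) unfolding dyadic_centre_eq_iff[OF assms(1)] * by simp
qed

lemma dyadic_cube_antimono:
  assumes "l > 0" "m \<le> n"
  shows "cube (dyadic_centre c l n x) (l / 2 ^ n) \<subseteq> cube (dyadic_centre c l m x) (l / 2 ^ m)"
  using dyadic_centre_antimono[OF assms] by (auto simp: mem_dyadic_cube[OF assms(1)])

lemma dyadic_centre_0:
  assumes "l > 0" "x \<in> cube c l"
  shows "dyadic_centre c l 0 x = c"
proof -
  have "\<lfloor>(x $ i - (c $ i - l / 2)) / l\<rfloor> = 0" for i
    using assms unfolding floor_eq_iff by (auto simp: cube_def field_simps)
  then show ?thesis by (simp add: dyadic_centre_def vec_eq_iff)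
qed

lemma dyadic_cube_subset:
  assumes "l > 0" "x \<in> cube c l"
  shows "cube (dyadic_centre c l n x) (l / 2 ^ n) \<subseteq> cube c l"
  using dyadic_cube_antimono[of l 0 n c x] dyadic_centre_0[OF assms] assms by simp

text \<open>
  Two dyadic cubes are nested or disjoint, so the first cubes at which a property holds along the
  chains of dyadic cubes shrinking to each point form a disjoint family.  Being disjoint with
  nonempty interiors, it is countable.
\<close>

lemma dyadic_stopping:
  fixes c :: "real ^ 'd" and P :: "real ^ 'd \<Rightarrow> real \<Rightarrow> bool"
  assumes "l > 0"
  obtains D where "countable D" "disjoint_family_on (\<lambda>(c, l). cube c l) D"
    "\<And>x n. P (dyadic_centre c l n x) (l / 2 ^ n) \<Longrightarrow> x \<in> (\<Union>(c, l)\<in>D. cube c l)"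
    "\<And>c' l'. (c', l') \<in> D \<Longrightarrow> \<exists>x n. c' = dyadic_centre c l n x \<and> l' = l / 2 ^ n \<and> P c' l' \<and>
        (\<forall>m<n. \<not> P (dyadic_centre c l m x) (l / 2 ^ m))"
proof -
  define Px where "Px x n \<longleftrightarrow> P (dyadic_centre c l n x) (l / 2 ^ n)" for x n
  define B where "B = {x. \<exists>n. Px x n}"
  \<comment> \<open>\<open>q x\<close> is the largest dyadic cube around \<open>x\<close> with property \<open>P\<close>.\<close>
  define N where "N x = (LEAST n. Px x n)" for x
  define q where "q x = (dyadic_centre c l (N x) x, l / 2 ^ N x)" for x
  define D where "D = q ` B"
  have N: "Px x (N x)" if "x \<in> B" for x
    using that unfolding B_def N_def by (auto intro: LeastI)
  have Nmin: "\<not> Px x m" if "m < N x" for x m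
    using that unfolding N_def by (rule not_less_Least)
  have meet: "q x = q y"
    if "x \<in> B" "y \<in> B" "N x \<le> N y" "z \<in> (\<lambda>(c, l). cube c l) (q x)" "z \<in> (\<lambda>(c, l). cube c l) (q y)" for x y z
  proof -
    have "dyadic_centre c l (N x) z = dyadic_centre c l (N x) x"
      "dyadic_centre c l (N y) z = dyadic_centre c l (N y) y"
      using that(4,5) by (auto simp: q_def mem_dyadic_cube[OF assms])
    then have eq: "dyadic_centre c l (N x) y = dyadic_centre c l (N x) x"
      using dyadic_centre_antimono[OF assms that(3)] by metis
    then have "Px y (N x)" using N[OF that(1)] by (simp add: Px_def)
    then have "N x = N y" using Nmin[of "N x" y] that(3) by force
    then show ?thesis using eq by (simp add: q_def)
  qed
  have disj: "q x = q y"
    if "x \<in> B" "y \<in> B" "z \<in> (\<lambda>(c, l). cube c l) (q x)" "z \<in> (\<lambda>(c, l). cube c l) (q y)" for x y z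
    using meet[OF that(1,2) _ that(3,4)] meet[OF that(2,1) _ that(4,3)] by (metis nle_le)
  have df: "disjoint_family_on (\<lambda>(c, l). cube c l) D"
    unfolding disjoint_family_on_def
  proof (intro ballI impI)
    fix p p' assume p: "p \<in> D" "p' \<in> D" "p \<noteq> p'"
    then obtain x y where xy: "x \<in> B" "y \<in> B" "p = q x" "p' = q y" unfolding D_def by blast
    show "(\<lambda>(c, l). cube c l) p \<inter> (\<lambda>(c, l). cube c l) p' = {}"
    proof (rule equals0I)
      fix z assume "z \<in> (\<lambda>(c, l). cube c l) p \<inter> (\<lambda>(c, l). cube c l) p'"
      then show False using disj[of x y z] xy p(3) by simp
    qed
  qed
  have pos: "l' > 0" if "(c', l') \<in> D" for c' l'
    using that assms by (auto simp: D_def q_def)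
  have inn: "c' \<in> interior (cube c' l')" if "l' > 0" for c' :: "real^'d" and l'
    using that by (intro interiorI[OF open_box _ box_subset_cube]) (auto simp: mem_box_cart)
  have "inj_on (\<lambda>(c, l). cube c l) D"
  proof (rule inj_onI)
    fix p p' assume p: "p \<in> D" "p' \<in> D" and eq: "(\<lambda>(c, l). cube c l) p = (\<lambda>(c, l). cube c l) p'"
    have "fst p \<in> (\<lambda>(c, l). cube c l) p"
      using pos p(1) by (cases p) (auto intro: centre_in_cube)
    then have "(\<lambda>(c, l). cube c l) p \<inter> (\<lambda>(c, l). cube c l) p' \<noteq> {}" using eq by auto
    then show "p = p'" using disjoint_family_onD[OF df p] by argo
  qed
  moreover have "countable ((\<lambda>(c, l). cube c l) ` D)"
  proof (rule countable_disjoint_nonempty_interior_subsets)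
    show "pairwise disjnt ((\<lambda>(c, l). cube c l) ` D)"
      using df by (intro pairwise_imageI) (simp add: disjoint_family_on_def disjnt_def)
    show "S = {}" if "S \<in> (\<lambda>(c, l). cube c l) ` D" "interior S = {}" for S
    proof -
      obtain c' l' where "(c', l') \<in> D" "S = cube c' l'" using \<open>S \<in> _\<close> by auto
      then show ?thesis using inn[of l' c'] pos[of c' l'] \<open>interior S = {}\<close> by simp
    qed
  qed
  ultimately have "countable D" by (rule countable_image_inj_on[rotated])
  moreover have "x \<in> (\<Union>(c, l)\<in>D. cube c l)" if "P (dyadic_centre c l n x) (l / 2 ^ n)" for x n
  proof -
    have "x \<in> B" using that by (auto simp: B_def Px_def)
    moreover have "x \<in> (\<lambda>(c, l). cube c l) (q x)" by (simp add: q_def mem_dyadic_cube[OF assms])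
    ultimately show ?thesis unfolding D_def by (intro UN_I[of "q x"]) auto
  qed
  moreover have "\<exists>x n. c' = dyadic_centre c l n x \<and> l' = l / 2 ^ n \<and> P c' l' \<and>
        (\<forall>m<n. \<not> P (dyadic_centre c l m x) (l / 2 ^ m))" if "(c', l') \<in> D" for c' l'
  proof -
    obtain x where "x \<in> B" "c' = dyadic_centre c l (N x) x" "l' = l / 2 ^ N x"
      using \<open>(c', l') \<in> D\<close> by (auto simp: D_def q_def)
    then show ?thesis using N[of x] Nmin[of _ x] unfolding Px_def by blast
  qed
  ultimately show ?thesis using df by (intro that[of D]) (assumption | rule)+
qed

section \<open>Dyadic density and the Calderon-Zygmund covering\<close>

lemma nn_integral_UN_countable:
  fixes f :: "'a \<Rightarrow> ennreal"
  assumes "f \<in> borel_measurable M" "\<And>i. i \<in> I \<Longrightarrow> X i \<in> sets M" "countable I" "disjoint_family_on X I"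
  shows "(\<integral>\<^sup>+x\<in>\<Union>(X ` I). f x \<partial>M) = (\<integral>\<^sup>+i. (\<integral>\<^sup>+x\<in>X i. f x \<partial>M) \<partial>count_space I)"
proof -
  have "\<Union>(X ` I) \<in> sets M" using assms by (intro sets.countable_UN') auto
  then have "(\<integral>\<^sup>+x\<in>\<Union>(X ` I). f x \<partial>M) = emeasure (density M f) (\<Union>(X ` I))"
    using assms by (simp add: emeasure_density)
  also have "\<dots> = (\<integral>\<^sup>+i. emeasure (density M f) (X i) \<partial>count_space I)"
    using assms by (intro emeasure_UN_countable) auto
  also have "\<dots> = (\<integral>\<^sup>+i. (\<integral>\<^sup>+x\<in>X i. f x \<partial>M) \<partial>count_space I)"
    using assms by (intro nn_integral_cong) (simp add: emeasure_density)
  finally show ?thesis .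
qed

lemma disjoint_family_on_Int:
  "disjoint_family_on X I \<Longrightarrow> disjoint_family_on (\<lambda>i. A \<inter> X i) I"
  unfolding disjoint_family_on_def by blast

lemma dyadic_cube_in_open:
  fixes x :: "real ^ 'd"
  assumes "open G" "x \<in> G" "l > 0"
  obtains n where "cube (dyadic_centre c l n x) (l / 2 ^ n) \<subseteq> G"
proof -
  obtain e where e: "e > 0" "ball x e \<subseteq> G" using assms by (meson openE)
  obtain n where n: "CARD('d) * l / e < 2 ^ n" using real_arch_pow[of 2 "CARD('d) * l / e"] by auto
  have "cube (dyadic_centre c l n x) (l / 2 ^ n) \<subseteq> ball x e"
  proof
    fix y assume y: "y \<in> cube (dyadic_centre c l n x) (l / 2 ^ n)"
    have "x \<in> cube (dyadic_centre c l n x) (l / 2 ^ n)" by (simp add: mem_dyadic_cube[OF assms(3)])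
    from norm_le_in_cube[OF this] norm_le_in_cube[OF y]
    have "dist x y \<le> CARD('d) * (l / 2 ^ n)"
      using dist_triangle2[of x y "dyadic_centre c l n x"] unfolding dist_norm by linarith
    also have "\<dots> < e" using n e by (simp add: field_simps)
    finally show "y \<in> ball x e" by simp
  qed
  then show ?thesis using e that by blast
qed

text \<open>
  If \<open>F\<close> had positive measure, then it would fill more than the fraction \<open>\<delta>\<close> of some open set around
  it.  But \<open>F\<close> is covered by disjoint dyadic cubes that lie in this open set, and \<open>E\<close> fills at most
  the fraction \<open>\<delta>\<close> of each of them.
\<close>

lemma dyadic_density:
  fixes c :: "real ^ 'd" and \<delta> :: real
  assumes E: "E \<in> sets lebesgue" "emeasure lebesgue E < \<infinity>" and "l > 0" and \<delta>: "0 < \<delta>" "\<delta> < 1"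
    and F: "F \<in> sets lebesgue" "F \<subseteq> E"
    and low: "\<And>x n. x \<in> F \<Longrightarrow> emeasure lebesgue (E \<inter> cube (dyadic_centre c l n x) (l / 2 ^ n))
        \<le> ennreal \<delta> * emeasure lebesgue (cube (dyadic_centre c l n x) (l / 2 ^ n))"
  shows "emeasure lebesgue F = 0"
proof (rule ccontr)
  assume nz: "emeasure lebesgue F \<noteq> 0"
  have fin: "F \<in> lmeasurable"
    by (rule fmeasurableI[OF F(1) le_less_trans[OF emeasure_mono[OF F(2) E(1)] E(2)]])
  define m where "m = measure lebesgue F"
  have m: "emeasure lebesgue F = ennreal m" "m > 0"
    using nz fin by (auto simp: m_def emeasure_eq_measure2 zero_less_measure_iff)
  have "m * (1 / \<delta> - 1) > 0" using m \<delta> by (auto intro!: mult_pos_pos simp: field_simps)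
  then obtain G where G: "open G" "F \<subseteq> G" "G - F \<in> lmeasurable"
      "emeasure lebesgue (G - F) < ennreal (m * (1 / \<delta> - 1))"
    using sets_lebesgue_outer_open[OF F(1)] by blast
  have GF: "G = F \<union> (G - F)" using G by auto
  have Gm: "G \<in> sets lebesgue" using G(1) by (simp add: sets_completionI_sets)
  have "emeasure lebesgue G = emeasure lebesgue F + emeasure lebesgue (G - F)"
    by (subst GF, subst plus_emeasure) (use F G in auto)
  also have "\<dots> < ennreal m + ennreal (m * (1 / \<delta> - 1))"
    using G(4) m by (simp add: ennreal_add_left_cancel_less)
  also have "\<dots> = ennreal (m / \<delta>)"
    using m \<delta> by (subst ennreal_plus[symmetric]) (auto simp: field_simps)
  finally have Gs: "emeasure lebesgue G < ennreal (m / \<delta>)" .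
  obtain D where D: "countable D" "disjoint_family_on (\<lambda>(c, l). cube c l) D"
    and cov: "\<And>x n. cube (dyadic_centre c l n x) (l / 2 ^ n) \<subseteq> G \<and> cube (dyadic_centre c l n x) (l / 2 ^ n) \<inter> F \<noteq> {}
         \<Longrightarrow> x \<in> (\<Union>(c, l)\<in>D. cube c l)"
    and el: "\<And>c' l'. (c', l') \<in> D \<Longrightarrow> \<exists>x n. c' = dyadic_centre c l n x \<and> l' = l / 2 ^ n \<and>
        (cube c' l' \<subseteq> G \<and> cube c' l' \<inter> F \<noteq> {}) \<and>
        (\<forall>m<n. \<not> (cube (dyadic_centre c l m x) (l / 2 ^ m) \<subseteq> G \<and> cube (dyadic_centre c l m x) (l / 2 ^ m) \<inter> F \<noteq> {}))"
    by (rule dyadic_stopping[OF \<open>l > 0\<close>, of "\<lambda>c' l'. cube c' l' \<subseteq> G \<and> cube c' l' \<inter> F \<noteq> {}" c]) (rule that)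
  define U where "U = (\<Union>(c, l)\<in>D. cube c l)"
  have "F \<subseteq> U"
  proof
    fix x assume x: "x \<in> F"
    then obtain n where "cube (dyadic_centre c l n x) (l / 2 ^ n) \<subseteq> G"
      using dyadic_cube_in_open[OF G(1) _ \<open>l > 0\<close>] G(2) by (metis subsetD)
    moreover have "x \<in> cube (dyadic_centre c l n x) (l / 2 ^ n)"
      by (simp add: mem_dyadic_cube[OF \<open>l > 0\<close>])
    ultimately show "x \<in> U" using cov[of n x] x unfolding U_def by blast
  qed
  have Um: "U \<in> sets lebesgue" unfolding U_def using D by (intro sets.countable_UN') auto
  have UG: "U \<subseteq> G" 
  proof
    fix y assume "y \<in> U"
    then obtain c' l' where "(c', l') \<in> D" "y \<in> cube c' l'" unfolding U_def by auto
    then show "y \<in> G" using el[of c' l'] by blast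
  qed
  have dens: "emeasure lebesgue (E \<inter> cube c' l') \<le> ennreal \<delta> * emeasure lebesgue (cube c' l')"
    if cl: "(c', l') \<in> D" for c' l'
  proof -
    obtain x n where *: "c' = dyadic_centre c l n x" "l' = l / 2 ^ n" "cube c' l' \<inter> F \<noteq> {}"
      using el[OF cl] by (elim exE conjE)
    then obtain y where "y \<in> F" "y \<in> cube c' l'" by blast
    then have "c' = dyadic_centre c l n y" "y \<in> F" using * by (auto simp: mem_dyadic_cube[OF \<open>l > 0\<close>])
    then show ?thesis using low[of y n] * by simp
  qed
  have "ennreal m \<le> emeasure lebesgue (E \<inter> U)"
    unfolding m(1)[symmetric] using F E Um \<open>F \<subseteq> U\<close> by (intro emeasure_mono) auto
  also have "E \<inter> U = (\<Union>p\<in>D. E \<inter> (\<lambda>(c, l). cube c l) p)" unfolding U_def by auto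
  also have "emeasure lebesgue \<dots> = (\<integral>\<^sup>+p. emeasure lebesgue (E \<inter> (\<lambda>(c, l). cube c l) p) \<partial>count_space D)"
    using D E by (intro emeasure_UN_countable disjoint_family_on_Int) auto
  also have "\<dots> \<le> (\<integral>\<^sup>+p. ennreal \<delta> * emeasure lebesgue ((\<lambda>(c, l). cube c l) p) \<partial>count_space D)"
    using dens by (intro nn_integral_mono) auto
  also have "\<dots> = ennreal \<delta> * (\<integral>\<^sup>+p. emeasure lebesgue ((\<lambda>(c, l). cube c l) p) \<partial>count_space D)"
    by (intro nn_integral_cmult) auto
  also have "(\<integral>\<^sup>+p. emeasure lebesgue ((\<lambda>(c, l). cube c l) p) \<partial>count_space D) = emeasure lebesgue U"
    unfolding U_def using D by (intro emeasure_UN_countable[symmetric]) auto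
  also have "ennreal \<delta> * emeasure lebesgue U \<le> ennreal \<delta> * emeasure lebesgue G"
    by (intro mult_left_mono emeasure_mono UG Gm) auto
  also have "\<dots> < ennreal \<delta> * ennreal (m / \<delta>)"
    using Gs \<delta> by (intro ennreal_mult_strict_left_mono) auto
  also have "\<dots> = ennreal m" using \<delta> m by (simp flip: ennreal_mult)
  finally show False by simp
qed

text \<open>
  The cubes are the maximal dyadic subcubes of the given cube \<open>Q\<close> on which \<open>E\<close> has density above \<open>2\<^sup>-\<^sup>d\<^sup>-\<^sup>1\<close>.  Being
  maximal bounds the density from above by \<open>1/2\<close> because the parent cube, of volume \<open>2\<^sup>d\<close> times
  larger, has low density; \<open>Q\<close> itself has low density, so that every selected cube has a parent.
  The lower density bound limits the total volume, and density points of \<open>E\<close> are covered.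
\<close>

lemma calderon_zygmund_covering:
  fixes c :: "real ^ 'd"
  assumes E: "E \<in> sets lebesgue" "E \<subseteq> cube c l" and "l > 0"
    and small: "4 * 2 ^ CARD('d) * emeasure lebesgue E \<le> emeasure lebesgue (cube c l)"
  obtains D where "countable D" "disjoint_family_on (\<lambda>(c, l). cube c l) D"
    "\<And>c' l'. (c', l') \<in> D \<Longrightarrow> l' > 0 \<and> cube c' l' \<subseteq> cube c l \<and>
        2 * emeasure lebesgue (E \<inter> cube c' l') \<le> emeasure lebesgue (cube c' l')"
    "2 * emeasure lebesgue (\<Union>(c, l)\<in>D. cube c l) \<le> emeasure lebesgue (cube c l)"
    "AE x in lebesgue. x \<in> E \<longrightarrow> x \<in> (\<Union>(c, l)\<in>D. cube c l)"
proof -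
  define P where "P c' l' \<longleftrightarrow> cube c' l' \<subseteq> cube c l \<and>
    emeasure lebesgue (cube c' l') < 2 * 2 ^ CARD('d) * emeasure lebesgue (E \<inter> cube c' l')"
    for c' :: "real ^ 'd" and l'
  obtain D where D: "countable D" "disjoint_family_on (\<lambda>(c, l). cube c l) D"
    and cov: "\<And>x n. P (dyadic_centre c l n x) (l / 2 ^ n) \<Longrightarrow> x \<in> (\<Union>(c, l)\<in>D. cube c l)"
    and el: "\<And>c' l'. (c', l') \<in> D \<Longrightarrow> \<exists>x n. c' = dyadic_centre c l n x \<and> l' = l / 2 ^ n \<and> P c' l' \<and>
        (\<forall>m<n. \<not> P (dyadic_centre c l m x) (l / 2 ^ m))"
    by (rule dyadic_stopping[OF \<open>l > 0\<close>, of P c]) (rule that)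
  define U where "U = (\<Union>(c, l)\<in>D. cube c l)"
  have Um: "U \<in> sets lebesgue" unfolding U_def using D by (intro sets.countable_UN') auto
  have Efin: "emeasure lebesgue E < \<infinity>"
    by (rule le_less_trans[OF emeasure_mono[OF E(2)] emeasure_cube_fin[OF \<open>l > 0\<close>]]) simp
  have notP: "\<not> P c l"
  proof
    assume "P c l"
    then have "emeasure lebesgue (cube c l) < 2 * 2 ^ CARD('d) * emeasure lebesgue (E \<inter> cube c l)"
      by (simp add: P_def)
    also have "\<dots> \<le> 4 * 2 ^ CARD('d) * emeasure lebesgue E"
      using E by (intro mult_mono emeasure_mono) auto
    also have "\<dots> \<le> emeasure lebesgue (cube c l)" by (rule small)
    finally show False by simp
  qed
  have sel: "l' > 0 \<and> cube c' l' \<subseteq> cube c l \<and>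
        2 * emeasure lebesgue (E \<inter> cube c' l') \<le> emeasure lebesgue (cube c' l')" and selP: "P c' l'"
    if cl: "(c', l') \<in> D" for c' l'
  proof -
    obtain x n where x: "c' = dyadic_centre c l n x" "l' = l / 2 ^ n" "P c' l'"
        "\<And>m. m<n \<Longrightarrow> \<not> P (dyadic_centre c l m x) (l / 2 ^ m)"
      using el[OF cl] by (elim exE conjE) simp
    show "P c' l'" by fact
    have "x \<in> cube c l"
      using x by (auto simp: P_def mem_dyadic_cube[OF \<open>l > 0\<close>])
    then have c0: "dyadic_centre c l 0 x = c" using dyadic_centre_0 \<open>l > 0\<close> by blast
    have "n \<noteq> 0" using c0 x(1-3) notP by (intro notI) simp
    then obtain k where k: "n = Suc k" by (cases n) auto
    let ?R = "cube (dyadic_centre c l k x) (l / 2 ^ k)"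
    have "?R \<subseteq> cube c l" using dyadic_cube_subset \<open>l > 0\<close> \<open>x \<in> cube c l\<close> by blast
    then have R: "2 * 2 ^ CARD('d) * emeasure lebesgue (E \<inter> ?R) \<le> emeasure lebesgue ?R"
      using x(4)[of k] k by (auto simp: P_def not_less)
    have sub: "cube c' l' \<subseteq> ?R" using x k dyadic_cube_antimono[of l k n c x] \<open>l > 0\<close> by simp
    have "2 ^ CARD('d) * (2 * emeasure lebesgue (E \<inter> cube c' l')) \<le> 2 * 2 ^ CARD('d) * emeasure lebesgue (E \<inter> ?R)"
      using sub E by (subst mult.assoc[symmetric], subst (2) mult.commute) (intro mult_mono emeasure_mono; auto)
    also have "\<dots> \<le> emeasure lebesgue ?R" by (rule R)
    also have "\<dots> = ennreal (2 ^ CARD('d) * l' ^ CARD('d))"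
    proof -
      have "l / 2 ^ k = 2 * l'" "0 < 2 * l'" using \<open>l > 0\<close> x k by auto
      then show ?thesis by (simp only: emeasure_cube power_mult_distrib)
    qed
    also have "\<dots> = 2 ^ CARD('d) * emeasure lebesgue (cube c' l')"
      using \<open>l > 0\<close> x by (subst emeasure_cube) (auto simp: ennreal_mult simp flip: ennreal_power)
    finally have "2 * emeasure lebesgue (E \<inter> cube c' l') \<le> emeasure lebesgue (cube c' l')"
      by (subst (asm) ennreal_mult_le_mult_iff) (auto simp: power_eq_top_ennreal)
    then show "l' > 0 \<and> cube c' l' \<subseteq> cube c l \<and>
        2 * emeasure lebesgue (E \<inter> cube c' l') \<le> emeasure lebesgue (cube c' l')"
      using x \<open>l > 0\<close> by (auto simp: P_def)
  qed
  have "2 * emeasure lebesgue U = 2 * (\<integral>\<^sup>+p. emeasure lebesgue ((\<lambda>(c, l). cube c l) p) \<partial>count_space D)"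
    unfolding U_def using D by (subst emeasure_UN_countable) auto
  also have "\<dots> \<le> 2 * (\<integral>\<^sup>+p. 2 * 2 ^ CARD('d) * emeasure lebesgue (E \<inter> (\<lambda>(c, l). cube c l) p) \<partial>count_space D)"
    using selP by (intro mult_left_mono nn_integral_mono) (auto simp: P_def less_imp_le)
  also have "\<dots> = 2 * (2 * 2 ^ CARD('d) * (\<integral>\<^sup>+p. emeasure lebesgue (E \<inter> (\<lambda>(c, l). cube c l) p) \<partial>count_space D))"
    by (subst nn_integral_cmult) auto
  also have "(\<integral>\<^sup>+p. emeasure lebesgue (E \<inter> (\<lambda>(c, l). cube c l) p) \<partial>count_space D)
      = emeasure lebesgue (\<Union>p\<in>D. E \<inter> (\<lambda>(c, l). cube c l) p)"
    using D E by (intro emeasure_UN_countable[symmetric] disjoint_family_on_Int) auto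
  also have "\<dots> \<le> emeasure lebesgue E" using E by (intro emeasure_mono) auto
  finally have "2 * emeasure lebesgue U \<le> 2 * (2 * 2 ^ CARD('d) * emeasure lebesgue E)"
    by (simp add: mult_left_mono)
  also have "\<dots> = 4 * 2 ^ CARD('d) * emeasure lebesgue E" by (simp add: mult.assoc[symmetric])
  also note small
  finally have U2: "2 * emeasure lebesgue U \<le> emeasure lebesgue (cube c l)" .
  have "emeasure lebesgue (E - U) = 0"
  proof (rule dyadic_density[OF E(1) Efin \<open>l > 0\<close>, of "1 / (2 * 2 ^ CARD('d))" _ c])
    show "1 / (2 * 2 ^ CARD('d)) < (1::real)"
      using one_le_power[of "2::real" "CARD('d)"] by (subst divide_less_eq_1_pos) linarith+
    fix x n assume x: "x \<in> E - U"
    then have "\<not> P (dyadic_centre c l n x) (l / 2 ^ n)" using cov[of n x] unfolding U_def by blast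
    moreover have "cube (dyadic_centre c l n x) (l / 2 ^ n) \<subseteq> cube c l"
      using x E dyadic_cube_subset[OF \<open>l > 0\<close>] by blast
    ultimately have *: "2 * 2 ^ CARD('d) * emeasure lebesgue (E \<inter> cube (dyadic_centre c l n x) (l / 2 ^ n))
        \<le> emeasure lebesgue (cube (dyadic_centre c l n x) (l / 2 ^ n))" (is "_ * ?a \<le> ?b")
      by (auto simp: P_def not_less)
    have "?a = ennreal (1 / (2 * 2 ^ CARD('d))) * (2 * 2 ^ CARD('d) * ?a)"
    proof -
      have "ennreal (1 / (2 * 2 ^ CARD('d))) * ennreal (2 * 2 ^ CARD('d)) = 1"
        by (subst ennreal_mult[symmetric]) auto
      moreover have "(2 * 2 ^ CARD('d) :: ennreal) = ennreal (2 * 2 ^ CARD('d))"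
        by (simp add: ennreal_mult ennreal_power[symmetric])
      ultimately show ?thesis by (simp add: mult.assoc[symmetric])
    qed
    also have "\<dots> \<le> ennreal (1 / (2 * 2 ^ CARD('d))) * ?b" by (intro mult_left_mono *) auto
    finally show "?a \<le> ennreal (1 / (2 * 2 ^ CARD('d))) * ?b" .
  qed (use E Um in auto)
  then have "AE x in lebesgue. x \<notin> E - U" using E Um by (intro AE_not_in) (auto simp: null_sets_def)
  then have "AE x in lebesgue. x \<in> E \<longrightarrow> x \<in> U" by eventually_elim auto
  with D sel U2 show ?thesis unfolding U_def by (intro that[of D])
qed

section \<open>Lower semicontinuity of the maximal operator\<close>

(* This rule replaces the Lebesgue measure of a set by the Borel measure of its main part, and then
   the facts about the Lebesgue measure of cubes no longer apply. *)
declare emeasure_completion [simp del]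

lemma enlarge_side:
  fixes I s :: ennreal and l :: real
  assumes "l > 0" "s < I / ennreal (l ^ d)"
  obtains l' where "l' > l" "s < I / ennreal (l' ^ d)"
proof (cases "I = top")
  case True
  moreover have "s < top" using assms(2) by (rule order.strict_trans2) simp
  ultimately show ?thesis using that[of "l + 1"] by (simp add: ennreal_top_divide)
next
  case False
  then obtain r where r: "I = ennreal r" "r \<ge> 0" by (cases I) auto
  have sr: "s < ennreal (r / l ^ d)" using assms r by (simp add: divide_ennreal)
  then obtain q where q: "s = ennreal q" "q \<ge> 0" by (cases s) auto
  have "q < r / l ^ d" using sr q by (simp add: ennreal_less_iff)
  moreover have "((\<lambda>t. r / t ^ d) \<longlongrightarrow> r / l ^ d) (at_right l)"
    using assms(1) by (intro tendsto_intros) auto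
  ultimately have "eventually (\<lambda>t. q < r / t ^ d \<and> l < t) (at_right l)"
    by (intro eventually_conj order_tendstoD(1) eventually_at_right_less)
  then obtain t where "q < r / t ^ d" "l < t"
    using eventually_happens trivial_limit_at_right_real by blast
  then show ?thesis using that[of t] r q assms(1) by (simp add: divide_ennreal ennreal_less_iff)
qed

text \<open>
  A cube whose average exceeds \<open>s\<close> can be enlarged slightly so that the average still exceeds
  \<open>s\<close>.  The original cube lies in the interior of the larger one, so \<^term>\<open>maximal_op f\<close> is lower
  semicontinuous.
\<close>

lemma borel_measurable_maximal_op [measurable]:
  fixes f :: "real ^ 'd \<Rightarrow> real"
  shows "maximal_op f \<in> borel_measurable lebesgue"
proof -
  have "open {x. s < maximal_op f x}" for s
  proof (subst open_subopen, intro ballI)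
    fix x assume "x \<in> {x. s < maximal_op f x}"
    then obtain c l where l: "l > 0"
      and s: "s < (\<integral>\<^sup>+y\<in>cube c l. ennreal \<bar>f y\<bar> \<partial>lebesgue) / emeasure lebesgue (cube c l) * indicator (cube c l) x"
      unfolding maximal_op_def by (auto simp: less_SUP_iff)
    have x: "x \<in> cube c l" using s by (cases "x \<in> cube c l") auto
    obtain l' where l': "l' > l"
      and s': "s < (\<integral>\<^sup>+y\<in>cube c l. ennreal \<bar>f y\<bar> \<partial>lebesgue) / ennreal (l' ^ CARD('d))"
      using s x l by (auto simp: emeasure_cube elim: enlarge_side)
    let ?B = "box (\<chi> i. c $ i - l' / 2) (\<chi> i. c $ i + l' / 2)"
    have "x \<in> ?B" using x l' by (auto simp: cube_def mem_box_cart) (smt (verit) field_sum_of_halves)+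
    moreover have "?B \<subseteq> {x. s < maximal_op f x}"
    proof safe
      fix y assume "y \<in> ?B"
      then have y: "y \<in> cube c l'" using box_subset_cube by blast
      note s'
      also have "(\<integral>\<^sup>+y\<in>cube c l. ennreal \<bar>f y\<bar> \<partial>lebesgue) / ennreal (l' ^ CARD('d))
         \<le> (\<integral>\<^sup>+y\<in>cube c l'. ennreal \<bar>f y\<bar> \<partial>lebesgue) / ennreal (l' ^ CARD('d))"
        using cube_mono[of l l' c] l'
        by (intro divide_right_mono_ennreal nn_integral_mono mult_left_mono) (auto simp: indicator_def)
      also have "\<dots> = (\<integral>\<^sup>+y\<in>cube c l'. ennreal \<bar>f y\<bar> \<partial>lebesgue) / emeasure lebesgue (cube c l') * indicator (cube c l') y"
        using y l l' by (simp add: emeasure_cube)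
      also have "\<dots> \<le> maximal_op f y"
        unfolding maximal_op_def using l l' by (intro SUP_upper2[of c] SUP_upper) auto
      finally show "s < maximal_op f y" .
    qed
    ultimately show "\<exists>T. open T \<and> x \<in> T \<and> T \<subseteq> {x. s < maximal_op f x}"
      using open_box by blast
  qed
  then have "maximal_op f \<in> borel_measurable borel"
    by (intro borel_measurableI_greater) auto
  then show ?thesis by (simp add: measurable_completion)
qed

lemma weight_avg_le_maximal_op:
  assumes "l > 0" "x \<in> cube c l"
  shows "weight_avg v (cube c l) \<le> maximal_op (\<lambda>y. indicat_real (cube c l) y * v y) x"
proof -
  let ?f = "\<lambda>y. indicat_real (cube c l) y * v y"
  have "weight_avg v (cube c l) \<le> (\<integral>\<^sup>+y\<in>cube c l. ennreal \<bar>?f y\<bar> \<partial>lebesgue) / emeasure lebesgue (cube c l)"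
    unfolding weight_avg_def weight_measure_def
    by (intro divide_right_mono_ennreal nn_integral_mono) (auto simp: indicator_def intro!: ennreal_leI)
  also have "\<dots> = (\<integral>\<^sup>+y\<in>cube c l. ennreal \<bar>?f y\<bar> \<partial>lebesgue) / emeasure lebesgue (cube c l) * indicator (cube c l) x"
    using assms by simp
  also have "\<dots> \<le> maximal_op ?f x"
    unfolding maximal_op_def using assms by (intro SUP_upper2[of c] SUP_upper) auto
  finally show ?thesis .
qed

lemma maximal_op_mono:
  assumes "\<And>y. \<bar>f y\<bar> \<le> \<bar>g y\<bar>"
  shows "maximal_op f x \<le> maximal_op g x"
  unfolding maximal_op_def
  by (intro SUP_mono' mult_right_mono divide_right_mono_ennreal nn_integral_mono ennreal_leI assms) auto

lemma weight_avg_times_volume: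
  "l > 0 \<Longrightarrow> weight_avg v (cube c l) * emeasure lebesgue (cube c l) = weight_measure v (cube c l)"
  unfolding weight_avg_def
  by (simp add: ennreal_divide_times emeasure_cube)

section \<open>From local oscillation to mean oscillation\<close>

lemma SUP_min_of_nat: "(SUP i. min x (of_nat i)) = (x :: ennreal)"
  unfolding inf_min[symmetric] by (subst inf_SUP[symmetric]) (simp add: ennreal_SUP_of_nat_eq_top)

lemma set_nn_integral_le_of_truncations:
  fixes h :: "'a \<Rightarrow> ennreal"
  assumes [measurable]: "h \<in> borel_measurable M" "A \<in> sets M"
    and le: "\<And>N::nat. (\<integral>\<^sup>+x\<in>A. min (h x) (of_nat N) \<partial>M) \<le> X"
  shows "(\<integral>\<^sup>+x\<in>A. h x \<partial>M) \<le> X"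
proof -
  have "(\<integral>\<^sup>+x\<in>A. h x \<partial>M) = (\<integral>\<^sup>+x. (SUP N. min (h x) (of_nat N) * indicator A x) \<partial>M)"
    by (intro nn_integral_cong) (simp add: SUP_min_of_nat flip: SUP_mult_right_ennreal)
  also have "\<dots> = (SUP N. (\<integral>\<^sup>+x\<in>A. min (h x) (of_nat N) \<partial>M))"
    by (intro nn_integral_monotone_convergence_SUP)
      (auto simp: incseq_def le_fun_def intro!: mult_right_mono min.mono)
  also have "\<dots> \<le> X" by (intro SUP_least le)
  finally show ?thesis .
qed

lemma set_nn_integral_Un_disjoint:
  fixes h :: "'a \<Rightarrow> ennreal"
  assumes [measurable]: "h \<in> borel_measurable M" "A \<in> sets M" "B \<in> sets M" and "A \<inter> B = {}"
  shows "(\<integral>\<^sup>+x\<in>A \<union> B. h x \<partial>M) = (\<integral>\<^sup>+x\<in>A. h x \<partial>M) + (\<integral>\<^sup>+x\<in>B. h x \<partial>M)"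
proof -
  have "(\<integral>\<^sup>+x\<in>A \<union> B. h x \<partial>M) = (\<integral>\<^sup>+x. h x * indicator A x + h x * indicator B x \<partial>M)"
    using assms(4) by (intro nn_integral_cong) (auto simp: indicator_def)
  then show ?thesis by (simp add: nn_integral_add)
qed

lemma ennreal_norm_triangle:
  fixes a b c :: "'a::real_normed_vector"
  shows "ennreal (norm (a - b)) \<le> ennreal (norm (a - c)) + ennreal (norm (c - b))"
  using norm_triangle_ineq[of "a - c" "c - b"] by (simp add: ennreal_leI flip: ennreal_plus)

lemma min_add_le: "min (a + b) N \<le> a + min b (N::ennreal)"
proof (cases "b \<le> N")
  case False
  have "min (a + b) N \<le> 0 + N" by simp
  also have "\<dots> \<le> a + N" by (intro add_mono) auto
  finally show ?thesis using False by (simp add: min_absorb2)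
qed (simp add: min_absorb1)

text \<open>
  The set of \<open>x\<close> in \<open>Q\<close> where \<open>g x\<close> is farther than \<open>\<alpha>\<close> from \<open>m\<close> fills at most half of each covering
  cube \<open>Q'\<close>, and the corresponding set of \<open>Q'\<close> fills at most an eighth of \<open>Q'\<close>.  So \<open>Q'\<close> contains a
  point that is good for both cubes, and there \<open>m\<close> for \<open>Q\<close> and for \<open>Q'\<close> can be compared.  The truncation at
  height \<open>N\<close> makes a finite remainder available when the estimate is iterated inside the covering
  cubes.
\<close>

lemma local_oscillation_step:
  fixes g :: "real ^ 'd \<Rightarrow> complex" and m :: "real ^ 'd \<Rightarrow> real \<Rightarrow> complex"
    and \<alpha> :: "real ^ 'd \<Rightarrow> real \<Rightarrow> ennreal" and N :: ennreal
  assumes g [measurable]: "g \<in> borel_measurable lebesgue"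
    and loc: "\<And>c l. l > 0 \<Longrightarrow>
      4 * 2 ^ CARD('d) * emeasure lebesgue {x \<in> cube c l. \<alpha> c l < ennreal (norm (g x - m c l))}
        \<le> emeasure lebesgue (cube c l)"
    and "l > 0"
  obtains D where "countable D" "disjoint_family_on (\<lambda>(c, l). cube c l) D"
    "\<And>c' l'. (c', l') \<in> D \<Longrightarrow> l' > 0 \<and> cube c' l' \<subseteq> cube c l"
    "2 * emeasure lebesgue (\<Union>(c, l)\<in>D. cube c l) \<le> emeasure lebesgue (cube c l)"
    "(\<integral>\<^sup>+x\<in>cube c l. min (ennreal (norm (g x - m c l))) N \<partial>lebesgue)
      \<le> \<alpha> c l * emeasure lebesgue (cube c l) +
        (\<integral>\<^sup>+(c', l'). \<alpha> c' l' * emeasure lebesgue (cube c' l') +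
           (\<integral>\<^sup>+x\<in>cube c' l'. min (ennreal (norm (g x - m c' l'))) N \<partial>lebesgue) \<partial>count_space D)"
proof -
  define E where "E c l = {x \<in> cube c l. \<alpha> c l < ennreal (norm (g x - m c l))}" for c l
  have Em [measurable]: "E c l \<in> sets lebesgue" for c l
  proof -
    have "{x \<in> space lebesgue. \<alpha> c l < ennreal (norm (g x - m c l))} \<in> sets lebesgue" by measurable
    then have "cube c l \<inter> {x \<in> space lebesgue. \<alpha> c l < ennreal (norm (g x - m c l))} \<in> sets lebesgue"
      by (intro sets.Int) auto
    moreover have "E c l = cube c l \<inter> {x \<in> space lebesgue. \<alpha> c l < ennreal (norm (g x - m c l))}"
      by (auto simp: E_def)
    ultimately show ?thesis by simp
  qed
  obtain D where D: "countable D" "disjoint_family_on (\<lambda>(c, l). cube c l) D"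
    and sub: "\<And>c' l'. (c', l') \<in> D \<Longrightarrow> l' > 0 \<and> cube c' l' \<subseteq> cube c l \<and>
        2 * emeasure lebesgue (E c l \<inter> cube c' l') \<le> emeasure lebesgue (cube c' l')"
    and half: "2 * emeasure lebesgue (\<Union>(c, l)\<in>D. cube c l) \<le> emeasure lebesgue (cube c l)"
    and cov: "AE x in lebesgue. x \<in> E c l \<longrightarrow> x \<in> (\<Union>(c, l)\<in>D. cube c l)"
    by (rule calderon_zygmund_covering[OF Em _ \<open>l > 0\<close>, of c l c])
      (use loc[OF \<open>l > 0\<close>, of c] in \<open>auto simp: E_def\<close>)
  define U where "U = (\<Union>(c, l)\<in>D. cube c l)"
  have Um [measurable]: "U \<in> sets lebesgue" unfolding U_def using D by (intro sets.countable_UN') auto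
  have UQ: "U \<subseteq> cube c l" unfolding U_def using sub by auto
  \<comment> \<open>The bad sets together fill at most 5/8 of \<open>Q'\<close>.\<close>
  have comp: "ennreal (norm (m c' l' - m c l)) \<le> \<alpha> c' l' + \<alpha> c l" if cl: "(c', l') \<in> D" for c' l'
  proof -
    let ?Q = "cube c' l'"
    have "l' > 0" using sub[OF cl] by simp
    have "\<exists>x\<in>?Q. x \<notin> E c l \<and> x \<notin> E c' l'"
    proof (rule ccontr)
      assume "\<not> (\<exists>x\<in>?Q. x \<notin> E c l \<and> x \<notin> E c' l')"
      then have "?Q \<subseteq> (E c l \<inter> ?Q) \<union> E c' l'" by auto
      then have "emeasure lebesgue ?Q \<le> emeasure lebesgue ((E c l \<inter> ?Q) \<union> E c' l')"
        by (intro emeasure_mono) auto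
      also have "\<dots> \<le> emeasure lebesgue (E c l \<inter> ?Q) + emeasure lebesgue (E c' l')"
        by (intro emeasure_subadditive) auto
      finally have "8 * emeasure lebesgue ?Q
          \<le> 4 * (2 * emeasure lebesgue (E c l \<inter> ?Q)) + 4 * 2 * emeasure lebesgue (E c' l')"
        by (drule_tac mult_left_mono[of _ _ "8::ennreal"]) (auto simp: distrib_left mult.assoc[symmetric])
      also have "\<dots> \<le> 4 * emeasure lebesgue ?Q + 4 * 2 ^ CARD('d) * emeasure lebesgue (E c' l')"
      proof (intro add_mono mult_left_mono mult_right_mono)
        show "2 * emeasure lebesgue (E c l \<inter> ?Q) \<le> emeasure lebesgue ?Q" using sub[OF cl] by blast
        show "2 \<le> (2 ^ CARD('d) :: ennreal)"
          using power_increasing[of 1 "CARD('d)" "2::ennreal"] by (simp add: Suc_le_eq)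
      qed auto
      also have "\<dots> \<le> 4 * emeasure lebesgue ?Q + emeasure lebesgue ?Q"
        using loc[OF \<open>l' > 0\<close>, of c'] by (intro add_mono) (auto simp: E_def)
      finally have "8 * ennreal (l' ^ CARD('d)) \<le> 4 * ennreal (l' ^ CARD('d)) + ennreal (l' ^ CARD('d))"
        unfolding emeasure_cube[OF \<open>l' > 0\<close>] .
      moreover define q where "q = l' ^ CARD('d)"
      have "q > 0" using \<open>l' > 0\<close> by (simp add: q_def)
      ultimately show False
        unfolding q_def[symmetric] by (simp add: numeral_mult_ennreal flip: ennreal_plus)
    qed
    then obtain x where x: "x \<in> ?Q" "x \<notin> E c l" "x \<notin> E c' l'" by blast
    then have "x \<in> cube c l" using sub[OF cl] by blast
    have "ennreal (norm (m c' l' - m c l)) \<le> ennreal (norm (m c' l' - g x)) + ennreal (norm (g x - m c l))"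
      by (rule ennreal_norm_triangle)
    also have "\<dots> \<le> \<alpha> c' l' + \<alpha> c l"
      using x \<open>x \<in> cube c l\<close> by (intro add_mono) (auto simp: E_def not_less norm_minus_commute)
    finally show ?thesis .
  qed
  let ?G = "\<lambda>c l x. min (ennreal (norm (g x - m c l))) N"
  let ?\<mu> = "emeasure lebesgue"
  have "(\<integral>\<^sup>+x\<in>cube c l. ?G c l x \<partial>lebesgue) = (\<integral>\<^sup>+x\<in>(cube c l - U) \<union> U. ?G c l x \<partial>lebesgue)"
    using UQ by (simp add: Un_absorb2)
  also have "\<dots> = (\<integral>\<^sup>+x\<in>cube c l - U. ?G c l x \<partial>lebesgue) + (\<integral>\<^sup>+x\<in>U. ?G c l x \<partial>lebesgue)"
    by (intro set_nn_integral_Un_disjoint) auto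
  also have "\<dots> \<le> \<alpha> c l * ?\<mu> (cube c l - U) +
      (\<alpha> c l * ?\<mu> U + (\<integral>\<^sup>+(c', l'). \<alpha> c' l' * ?\<mu> (cube c' l') + (\<integral>\<^sup>+x\<in>cube c' l'. ?G c' l' x \<partial>lebesgue) \<partial>count_space D))"
  proof (intro add_mono)
    have "(\<integral>\<^sup>+x\<in>cube c l - U. ?G c l x \<partial>lebesgue) \<le> (\<integral>\<^sup>+x. \<alpha> c l * indicator (cube c l - U) x \<partial>lebesgue)"
    proof (rule nn_integral_mono_AE, use cov in eventually_elim)
      fix x assume "x \<in> E c l \<longrightarrow> x \<in> (\<Union>(c, l)\<in>D. cube c l)"
      then have "x \<in> cube c l - U \<Longrightarrow> ennreal (norm (g x - m c l)) \<le> \<alpha> c l"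
        by (auto simp: E_def U_def not_less)
      then show "?G c l x * indicator (cube c l - U) x \<le> \<alpha> c l * indicator (cube c l - U) x"
        by (cases "x \<in> cube c l - U") (auto intro: min.coboundedI1)
    qed
    also have "\<dots> = \<alpha> c l * ?\<mu> (cube c l - U)" by (intro nn_integral_cmult_indicator) auto
    finally show "(\<integral>\<^sup>+x\<in>cube c l - U. ?G c l x \<partial>lebesgue) \<le> \<alpha> c l * ?\<mu> (cube c l - U)" .
    have "(\<integral>\<^sup>+x\<in>U. ?G c l x \<partial>lebesgue) = (\<integral>\<^sup>+p. (\<integral>\<^sup>+x\<in>(\<lambda>(c, l). cube c l) p. ?G c l x \<partial>lebesgue) \<partial>count_space D)"
      unfolding U_def using D by (intro nn_integral_UN_countable) auto
    also have "\<dots> \<le> (\<integral>\<^sup>+p. \<alpha> c l * ?\<mu> ((\<lambda>(c, l). cube c l) p) + (case p of (c', l') \<Rightarrow> \<alpha> c' l' * ?\<mu> (cube c' l')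
         + (\<integral>\<^sup>+x\<in>cube c' l'. ?G c' l' x \<partial>lebesgue)) \<partial>count_space D)"
    proof (rule nn_integral_mono)
      fix p assume "p \<in> space (count_space D)"
      moreover obtain c' l' where p: "p = (c', l')" by (cases p)
      ultimately have cl: "(c', l') \<in> D" by simp
      have "(\<integral>\<^sup>+x\<in>cube c' l'. ?G c l x \<partial>lebesgue)
         \<le> (\<integral>\<^sup>+x. (\<alpha> c l + \<alpha> c' l') * indicator (cube c' l') x + ?G c' l' x * indicator (cube c' l') x \<partial>lebesgue)"
      proof (rule nn_integral_mono)
        fix x
        have "?G c l x \<le> min ((\<alpha> c l + \<alpha> c' l') + ennreal (norm (g x - m c' l'))) N"
        proof (intro min.mono order_refl)
          have "ennreal (norm (g x - m c l)) \<le> ennreal (norm (g x - m c' l')) + ennreal (norm (m c' l' - m c l))"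
            by (rule ennreal_norm_triangle)
          also have "\<dots> \<le> ennreal (norm (g x - m c' l')) + (\<alpha> c' l' + \<alpha> c l)"
            by (intro add_mono comp[OF cl]) auto
          finally show "ennreal (norm (g x - m c l)) \<le> \<alpha> c l + \<alpha> c' l' + ennreal (norm (g x - m c' l'))"
            by (simp add: ac_simps)
        qed
        also have "\<dots> \<le> (\<alpha> c l + \<alpha> c' l') + ?G c' l' x" by (rule min_add_le)
        finally show "?G c l x * indicator (cube c' l') x \<le>
            (\<alpha> c l + \<alpha> c' l') * indicator (cube c' l') x + ?G c' l' x * indicator (cube c' l') x"
          by (simp add: indicator_def)
      qed
      also have "\<dots> = (\<alpha> c l + \<alpha> c' l') * ?\<mu> (cube c' l') + (\<integral>\<^sup>+x\<in>cube c' l'. ?G c' l' x \<partial>lebesgue)"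
        by (subst nn_integral_add) (auto simp: nn_integral_cmult_indicator)
      also have "\<dots> = \<alpha> c l * ?\<mu> (cube c' l') + (\<alpha> c' l' * ?\<mu> (cube c' l') + (\<integral>\<^sup>+x\<in>cube c' l'. ?G c' l' x \<partial>lebesgue))"
        by (simp only: distrib_right add.assoc)
      finally show "(\<integral>\<^sup>+x\<in>(case p of (c, l) \<Rightarrow> cube c l). ?G c l x \<partial>lebesgue)
        \<le> \<alpha> c l * ?\<mu> (case p of (c, l) \<Rightarrow> cube c l) + (case p of (c', l') \<Rightarrow> \<alpha> c' l' * ?\<mu> (cube c' l')
         + (\<integral>\<^sup>+x\<in>cube c' l'. ?G c' l' x \<partial>lebesgue))" by (simp only: p prod.case)
    qed
    also have "\<dots> = \<alpha> c l * (\<integral>\<^sup>+p. ?\<mu> ((\<lambda>(c, l). cube c l) p) \<partial>count_space D) +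
        (\<integral>\<^sup>+(c', l'). \<alpha> c' l' * ?\<mu> (cube c' l') + (\<integral>\<^sup>+x\<in>cube c' l'. ?G c' l' x \<partial>lebesgue) \<partial>count_space D)"
      by (subst nn_integral_add) (auto simp: nn_integral_cmult)
    also have "(\<integral>\<^sup>+p. ?\<mu> ((\<lambda>(c, l). cube c l) p) \<partial>count_space D) = ?\<mu> U"
      unfolding U_def using D by (intro emeasure_UN_countable[symmetric]) auto
    finally show "(\<integral>\<^sup>+x\<in>U. ?G c l x \<partial>lebesgue) \<le> \<alpha> c l * ?\<mu> U +
        (\<integral>\<^sup>+(c', l'). \<alpha> c' l' * ?\<mu> (cube c' l') + (\<integral>\<^sup>+x\<in>cube c' l'. ?G c' l' x \<partial>lebesgue) \<partial>count_space D)" .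
  qed
  also have "\<dots> = \<alpha> c l * (?\<mu> (cube c l - U) + ?\<mu> U) +
      (\<integral>\<^sup>+(c', l'). \<alpha> c' l' * ?\<mu> (cube c' l') + (\<integral>\<^sup>+x\<in>cube c' l'. ?G c' l' x \<partial>lebesgue) \<partial>count_space D)"
    by (simp only: distrib_left add.assoc)
  also have "?\<mu> (cube c l - U) + ?\<mu> U = ?\<mu> (cube c l)"
    using UQ by (subst plus_emeasure) (auto simp: Un_absorb2)
  finally show ?thesis
    using that[OF D] sub half by blast
qed

text \<open>
  At least half of \<open>Q\<close> lies outside the covering cubes, and on all of \<open>Q\<close> the maximal function is at
  least the average of \<open>v\<close> over \<open>Q\<close>; so the integral of the maximal function over this half pays for
  the terms \<open>a v(Q)\<close> of one step, and its integrals over the covering cubes pay, inductively, for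
  the rest.  Since the covering cubes fill at most half of \<open>Q\<close>, after \<open>n\<close> steps the trivial bound \<open>N\<close>
  contributes at most \<open>2\<^sup>-\<^sup>n N |Q|\<close>.
\<close>

lemma oscillation_le_maximal_op:
  fixes g :: "real ^ 'd \<Rightarrow> complex" and v :: "real ^ 'd \<Rightarrow> real" and a :: ennreal
  assumes g [measurable]: "g \<in> borel_measurable lebesgue"
    and loc: "\<And>c l. l > 0 \<Longrightarrow> \<exists>m.
      4 * 2 ^ CARD('d) * emeasure lebesgue {x \<in> cube c l. a * weight_avg v (cube c l) < ennreal (norm (g x - m))}
        \<le> emeasure lebesgue (cube c l)"
    and "l > 0"
  shows "\<exists>m. (\<integral>\<^sup>+x\<in>cube c l. ennreal (norm (g x - m)) \<partial>lebesgue)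
    \<le> 4 * a * (\<integral>\<^sup>+x\<in>cube c l. maximal_op (\<lambda>y. indicat_real (cube c l) y * v y) x \<partial>lebesgue)"
proof -
  define \<alpha> where "\<alpha> c l = a * weight_avg v (cube c l)" for c l
  define m where "m c l = (SOME z. 4 * 2 ^ CARD('d) *
      emeasure lebesgue {x \<in> cube c l. \<alpha> c l < ennreal (norm (g x - z))} \<le> emeasure lebesgue (cube c l))" for c l
  have m: "4 * 2 ^ CARD('d) * emeasure lebesgue {x \<in> cube c l. \<alpha> c l < ennreal (norm (g x - m c l))}
        \<le> emeasure lebesgue (cube c l)" if "l > 0" for c l
    unfolding m_def by (rule someI_ex) (use loc[OF that] in \<open>simp add: \<alpha>_def\<close>)
  let ?M = "\<lambda>c l. maximal_op (\<lambda>y. indicat_real (cube c l) y * v y)"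
  let ?\<mu> = "emeasure lebesgue"
  have \<alpha>v: "\<alpha> c l * ?\<mu> (cube c l) = a * weight_measure v (cube c l)" if "l > 0" for c l
    using that by (simp add: \<alpha>_def mult.assoc weight_avg_times_volume)
  have vM: "weight_avg v (cube c l) * ?\<mu> A \<le> (\<integral>\<^sup>+x\<in>A. ?M c l x \<partial>lebesgue)"
    if "l > 0" "A \<subseteq> cube c l" "A \<in> sets lebesgue" for c l A
  proof -
    have "weight_avg v (cube c l) * ?\<mu> A = (\<integral>\<^sup>+x\<in>A. weight_avg v (cube c l) \<partial>lebesgue)"
      using that by (simp add: nn_integral_cmult_indicator)
    also have "\<dots> \<le> (\<integral>\<^sup>+x\<in>A. ?M c l x \<partial>lebesgue)"
      using that weight_avg_le_maximal_op[OF that(1)]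
      by (intro nn_integral_mono) (auto simp: indicator_def)
    finally show ?thesis .
  qed
  define G where "G N c l = (\<integral>\<^sup>+x\<in>cube c l. min (ennreal (norm (g x - m c l))) (of_nat N) \<partial>lebesgue)" for N c l
  \<comment> \<open>The summand \<open>a v(Q)\<close> on the left is what the previous step of the iteration charges to the cube \<open>Q\<close>.\<close>
  have it: "\<alpha> c l * ?\<mu> (cube c l) + G N c l
     \<le> 4 * a * (\<integral>\<^sup>+x\<in>cube c l. ?M c l x \<partial>lebesgue) + of_nat N * ?\<mu> (cube c l) * ennreal ((1/2) ^ n)"
    if "l > 0" for n N c l
    using that
  proof (induction n arbitrary: c l)
    case 0
    have "\<alpha> c l * ?\<mu> (cube c l) \<le> a * (\<integral>\<^sup>+x\<in>cube c l. ?M c l x \<partial>lebesgue)"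
      unfolding \<alpha>_def mult.assoc using 0 by (intro mult_left_mono vM) auto
    also have "\<dots> \<le> 4 * a * (\<integral>\<^sup>+x\<in>cube c l. ?M c l x \<partial>lebesgue)"
      using mult_right_mono[of 1 4 a] by (intro mult_right_mono) auto
    finally have "\<alpha> c l * ?\<mu> (cube c l) \<le> 4 * a * (\<integral>\<^sup>+x\<in>cube c l. ?M c l x \<partial>lebesgue)" .
    moreover have "G N c l \<le> of_nat N * ?\<mu> (cube c l)"
    proof -
      have "G N c l \<le> (\<integral>\<^sup>+x\<in>cube c l. of_nat N \<partial>lebesgue)"
        unfolding G_def by (intro nn_integral_mono mult_right_mono) auto
      then show ?thesis by (simp add: nn_integral_cmult_indicator)
    qed
    ultimately show ?case by (auto intro: add_mono)
  next
    case (Suc n)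
    obtain D where D: "countable D" "disjoint_family_on (\<lambda>(c, l). cube c l) D"
      and sub: "\<And>c' l'. (c', l') \<in> D \<Longrightarrow> l' > 0 \<and> cube c' l' \<subseteq> cube c l"
      and half: "2 * ?\<mu> (\<Union>(c, l)\<in>D. cube c l) \<le> ?\<mu> (cube c l)"
      and step: "G N c l \<le> \<alpha> c l * ?\<mu> (cube c l) + (\<integral>\<^sup>+(c', l'). \<alpha> c' l' * ?\<mu> (cube c' l') + G N c' l' \<partial>count_space D)"
      unfolding G_def by (rule local_oscillation_step[where \<alpha>=\<alpha> and m=m and N="of_nat N" and c=c, OF g m \<open>l > 0\<close>]) (assumption, rule that[unfolded G_def])
    define U where "U = (\<Union>(c, l)\<in>D. cube c l)"
    have Um [measurable]: "U \<in> sets lebesgue" unfolding U_def using D by (intro sets.countable_UN') auto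
    have UQ: "U \<subseteq> cube c l" unfolding U_def using sub by auto
    have "?\<mu> (cube c l) \<le> 2 * ?\<mu> (cube c l - U)"
    proof -
      have Q: "?\<mu> (cube c l - U) + ?\<mu> U = ?\<mu> (cube c l)"
        using UQ by (subst plus_emeasure) (auto simp: Un_absorb2)
      have "?\<mu> (cube c l) + ?\<mu> (cube c l) = 2 * ?\<mu> (cube c l - U) + 2 * ?\<mu> U"
        unfolding distrib_left[symmetric] Q by (simp add: mult_2)
      also have "\<dots> \<le> 2 * ?\<mu> (cube c l - U) + ?\<mu> (cube c l)"
        using half by (intro add_mono) (auto simp: U_def)
      finally have "?\<mu> (cube c l) + ?\<mu> (cube c l) \<le> ?\<mu> (cube c l) + 2 * ?\<mu> (cube c l - U)"
        by (simp only: add.commute)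
      then show ?thesis
        using emeasure_cube_nt[OF \<open>l > 0\<close>, of c] unfolding ennreal_add_left_cancel_le by simp
    qed
    then have "2 * (\<alpha> c l * ?\<mu> (cube c l)) \<le> 2 * (\<alpha> c l * (2 * ?\<mu> (cube c l - U)))"
      by (intro mult_left_mono) auto
    also have "\<dots> = 4 * a * (weight_avg v (cube c l) * ?\<mu> (cube c l - U))"
    proof -
      have "(4::ennreal) = 2 * 2" by simp
      then show ?thesis by (simp only: \<alpha>_def ac_simps)
    qed
    also have "\<dots> \<le> 4 * a * (\<integral>\<^sup>+x\<in>cube c l - U. ?M c l x \<partial>lebesgue)"
      using \<open>l > 0\<close> by (intro mult_left_mono vM) auto
    finally have p1: "2 * (\<alpha> c l * ?\<mu> (cube c l)) \<le> 4 * a * (\<integral>\<^sup>+x\<in>cube c l - U. ?M c l x \<partial>lebesgue)" .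
    have "(\<integral>\<^sup>+(c', l'). \<alpha> c' l' * ?\<mu> (cube c' l') + G N c' l' \<partial>count_space D)
      \<le> (\<integral>\<^sup>+p. 4 * a * (\<integral>\<^sup>+x\<in>(\<lambda>(c, l). cube c l) p. ?M c l x \<partial>lebesgue)
           + of_nat N * ennreal ((1/2) ^ n) * ?\<mu> ((\<lambda>(c, l). cube c l) p) \<partial>count_space D)"
    proof (rule nn_integral_mono)
      fix p assume "p \<in> space (count_space D)"
      moreover obtain c' l' where p: "p = (c', l')" by (cases p)
      ultimately have cl: "l' > 0" "cube c' l' \<subseteq> cube c l" using sub by auto
      have "\<alpha> c' l' * ?\<mu> (cube c' l') + G N c' l'
        \<le> 4 * a * (\<integral>\<^sup>+x\<in>cube c' l'. ?M c' l' x \<partial>lebesgue) + of_nat N * ?\<mu> (cube c' l') * ennreal ((1/2) ^ n)"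
        using Suc.IH cl by blast
      also have "\<dots> \<le> 4 * a * (\<integral>\<^sup>+x\<in>cube c' l'. ?M c l x \<partial>lebesgue) + of_nat N * ?\<mu> (cube c' l') * ennreal ((1/2) ^ n)"
        using cl(2) by (intro add_mono mult_left_mono nn_integral_mono mult_right_mono maximal_op_mono)
          (auto simp: indicator_def)
      finally show "(case p of (c', l') \<Rightarrow> \<alpha> c' l' * ?\<mu> (cube c' l') + G N c' l')
        \<le> 4 * a * (\<integral>\<^sup>+x\<in>(case p of (c, l) \<Rightarrow> cube c l). ?M c l x \<partial>lebesgue)
           + of_nat N * ennreal ((1/2) ^ n) * ?\<mu> (case p of (c, l) \<Rightarrow> cube c l)"
        by (simp only: p prod.case ac_simps)
    qed
    also have "\<dots> = 4 * a * (\<integral>\<^sup>+p. (\<integral>\<^sup>+x\<in>(\<lambda>(c, l). cube c l) p. ?M c l x \<partial>lebesgue) \<partial>count_space D)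
        + of_nat N * ennreal ((1/2) ^ n) * (\<integral>\<^sup>+p. ?\<mu> ((\<lambda>(c, l). cube c l) p) \<partial>count_space D)"
      by (subst nn_integral_add) (auto simp: nn_integral_cmult)
    also have "(\<integral>\<^sup>+p. ?\<mu> ((\<lambda>(c, l). cube c l) p) \<partial>count_space D) = ?\<mu> U"
      unfolding U_def using D by (intro emeasure_UN_countable[symmetric]) auto
    also have "(\<integral>\<^sup>+p. (\<integral>\<^sup>+x\<in>(\<lambda>(c, l). cube c l) p. ?M c l x \<partial>lebesgue) \<partial>count_space D)
       = (\<integral>\<^sup>+x\<in>U. ?M c l x \<partial>lebesgue)"
      unfolding U_def using D by (intro nn_integral_UN_countable[symmetric]) auto
    also have "of_nat N * ennreal ((1/2) ^ n) * ?\<mu> U = of_nat N * (2 * ?\<mu> U) * ennreal ((1/2) ^ Suc n)"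
    proof -
      have "ennreal ((1/2) ^ n) = 2 * ennreal ((1/2) ^ Suc n)" by (simp add: numeral_mult_ennreal)
      then show ?thesis by (simp add: ac_simps)
    qed
    also have "\<dots> \<le> of_nat N * ?\<mu> (cube c l) * ennreal ((1/2) ^ Suc n)"
      using half by (intro mult_left_mono mult_right_mono) (auto simp: U_def)
    finally have p2: "(\<integral>\<^sup>+(c', l'). \<alpha> c' l' * ?\<mu> (cube c' l') + G N c' l' \<partial>count_space D)
      \<le> 4 * a * (\<integral>\<^sup>+x\<in>U. ?M c l x \<partial>lebesgue) + of_nat N * ?\<mu> (cube c l) * ennreal ((1/2) ^ Suc n)"
      by (simp add: add_left_mono)
    have "\<alpha> c l * ?\<mu> (cube c l) + G N c l \<le> 2 * (\<alpha> c l * ?\<mu> (cube c l)) +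
        (\<integral>\<^sup>+(c', l'). \<alpha> c' l' * ?\<mu> (cube c' l') + G N c' l' \<partial>count_space D)"
      using add_left_mono[OF step, of "\<alpha> c l * ?\<mu> (cube c l)"] by (simp add: mult_2 add.assoc)
    also have "\<dots> \<le> 4 * a * (\<integral>\<^sup>+x\<in>cube c l - U. ?M c l x \<partial>lebesgue) +
       (4 * a * (\<integral>\<^sup>+x\<in>U. ?M c l x \<partial>lebesgue) + of_nat N * ?\<mu> (cube c l) * ennreal ((1/2) ^ Suc n))"
      by (intro add_mono p1 p2)
    also have "\<dots> = 4 * a * ((\<integral>\<^sup>+x\<in>cube c l - U. ?M c l x \<partial>lebesgue) + (\<integral>\<^sup>+x\<in>U. ?M c l x \<partial>lebesgue))
        + of_nat N * ?\<mu> (cube c l) * ennreal ((1/2) ^ Suc n)"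
      by (simp only: distrib_left add.assoc)
    also have "(\<integral>\<^sup>+x\<in>cube c l - U. ?M c l x \<partial>lebesgue) + (\<integral>\<^sup>+x\<in>U. ?M c l x \<partial>lebesgue)
        = (\<integral>\<^sup>+x\<in>(cube c l - U) \<union> U. ?M c l x \<partial>lebesgue)"
      by (intro set_nn_integral_Un_disjoint[symmetric]) auto
    also have "(cube c l - U) \<union> U = cube c l" using UQ by auto
    finally show ?case .
  qed
  have G_le: "G N c l \<le> 4 * a * (\<integral>\<^sup>+x\<in>cube c l. ?M c l x \<partial>lebesgue)" for N
  proof (rule ennreal_le_epsilon)
    fix e :: real assume "e > 0"
    let ?r = "real N * l ^ CARD('d)"
    have "((\<lambda>n. ?r * (1/2) ^ n) \<longlonglongrightarrow> ?r * 0)"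
      by (intro tendsto_mult tendsto_const LIMSEQ_power_zero) auto
    then have "eventually (\<lambda>n. ?r * (1/2) ^ n < e) sequentially"
      using \<open>e > 0\<close> by (intro order_tendstoD(2)) auto
    then obtain n where n: "?r * (1/2) ^ n < e" using eventually_happens'[OF sequentially_bot] by blast
    have "G N c l \<le> \<alpha> c l * ?\<mu> (cube c l) + G N c l" by simp
    also have "\<dots> \<le> 4 * a * (\<integral>\<^sup>+x\<in>cube c l. ?M c l x \<partial>lebesgue) + of_nat N * ?\<mu> (cube c l) * ennreal ((1/2) ^ n)"
      by (rule it[OF \<open>l > 0\<close>])
    also have "of_nat N * ?\<mu> (cube c l) * ennreal ((1/2) ^ n) = ennreal (?r * (1/2) ^ n)"
    proof -
      have "ennreal (?r * (1/2) ^ n) = ennreal ?r * ennreal ((1/2) ^ n)"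
        using \<open>l > 0\<close> by (intro ennreal_mult) auto
      moreover have "ennreal ?r = ennreal (real N) * ennreal (l ^ CARD('d))"
        using \<open>l > 0\<close> by (intro ennreal_mult) auto
      ultimately show ?thesis
        by (simp only: emeasure_cube[OF \<open>l > 0\<close>] ennreal_of_nat_eq_real_of_nat)
    qed
    also have "\<dots> \<le> ennreal e" using n by (intro ennreal_leI) simp
    finally show "G N c l \<le> 4 * a * (\<integral>\<^sup>+x\<in>cube c l. ?M c l x \<partial>lebesgue) + ennreal e"
      by (simp add: add_left_mono)
  qed
  have "(\<integral>\<^sup>+x\<in>cube c l. ennreal (norm (g x - m c l)) \<partial>lebesgue)
    \<le> 4 * a * (\<integral>\<^sup>+x\<in>cube c l. ?M c l x \<partial>lebesgue)"
    by (rule set_nn_integral_le_of_truncations) (use G_le in \<open>simp_all add: G_def\<close>)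
  then show ?thesis by blast
qed

section \<open>The essential support\<close>

lemma closed_ess_support: "closed (ess_support f)"
  unfolding ess_support_def by (intro closed_Compl open_Union) auto

text \<open>
  The complement of the support is a union of uncountably many open sets, each of which carries
  an exceptional null set; by the Lindelof property countably many of them suffice.
\<close>

lemma AE_zero_off_ess_support: "AE x in lebesgue. x \<notin> ess_support f \<longrightarrow> f x = 0"
proof -
  let ?F = "{U. open U \<and> (AE x in lebesgue. x \<in> U \<longrightarrow> f x = 0)}"
  obtain F where F: "F \<subseteq> ?F" "countable F" "\<Union>F = \<Union>?F"
    using Lindelof[of ?F] by auto
  have "AE x in lebesgue. \<forall>U\<in>F. x \<in> U \<longrightarrow> f x = 0"
    using F by (subst AE_ball_countable) auto
  then show ?thesis
  proof eventually_elim
    case (elim x)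
    have "x \<notin> ess_support f \<longleftrightarrow> x \<in> \<Union>F" unfolding F(3) ess_support_def by (rule Compl_iff[THEN arg_cong[of _ _ Not], unfolded not_not])
    then show ?case using elim by blast
  qed
qed

lemma not_in_ess_supportI:
  assumes "open U" "x \<in> U" "\<And>y. y \<in> U \<Longrightarrow> f y = 0"
  shows "x \<notin> ess_support f"
  unfolding ess_support_def using assms by auto

lemma ess_support_mono:
  assumes "\<And>x. f x = 0 \<Longrightarrow> g x = 0"
  shows "ess_support g \<subseteq> ess_support f"
proof -
  have "AE x in lebesgue. x \<in> U \<longrightarrow> g x = 0" if "AE x in lebesgue. x \<in> U \<longrightarrow> f x = 0" for U
    using that by eventually_elim (use assms in blast)
  then show ?thesis unfolding ess_support_def by blast
qed

section \<open>Moduli of continuity\<close>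

locale modulus =
  fixes \<Omega> :: "real \<Rightarrow> real"
  assumes nonneg: "0 \<le> t \<Longrightarrow> 0 \<le> \<Omega> t"
    and mono: "mono_on {0..} \<Omega>"
    and subadd: "0 \<le> s \<Longrightarrow> 0 \<le> t \<Longrightarrow> \<Omega> (s + t) \<le> \<Omega> s + \<Omega> t"
    and nontrivial: "\<exists>t\<ge>0. \<Omega> t \<noteq> 0"
    and zero: "\<Omega> 0 = 0"
begin

lemma monoD: "0 \<le> s \<Longrightarrow> s \<le> t \<Longrightarrow> \<Omega> s \<le> \<Omega> t"
  using mono by (auto simp: mono_on_def)

lemma multiple_le:
  assumes "0 \<le> t"
  shows "\<Omega> (real n * t) \<le> real n * \<Omega> t"
proof (induction n)
  case (Suc n)
  have "\<Omega> (real (Suc n) * t) = \<Omega> (real n * t + t)" by (simp add: algebra_simps)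
  also have "\<dots> \<le> \<Omega> (real n * t) + \<Omega> t" using assms by (intro subadd) auto
  finally show ?case using Suc by (simp add: algebra_simps)
qed (simp add: zero)

text \<open>A zero of \<open>\<Omega>\<close> at some \<open>t > 0\<close> would propagate to all multiples of \<open>t\<close> by subadditivity.\<close>

lemma pos:
  assumes "0 < t"
  shows "0 < \<Omega> t"
proof (rule ccontr)
  assume "\<not> 0 < \<Omega> t"
  then have z: "\<Omega> t = 0" using nonneg[of t] assms by simp
  obtain s where s: "s \<ge> 0" "\<Omega> s \<noteq> 0" using nontrivial by blast
  obtain n :: nat where "s / t \<le> real n" using real_arch_simple by blast
  then have "\<Omega> s \<le> \<Omega> (real n * t)" using s assms by (intro monoD) (auto simp: field_simps)
  also have "\<dots> \<le> real n * \<Omega> t" using assms by (intro multiple_le) auto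
  finally show False using z s nonneg[of s] by simp
qed

lemma borel_measurable_comp:
  assumes "h \<in> borel_measurable M" "\<And>x. x \<in> space M \<Longrightarrow> 0 \<le> h x"
  shows "(\<lambda>x. \<Omega> (h x)) \<in> borel_measurable M"
proof -
  have "mono (\<lambda>t. \<Omega> (max 0 t))" by (auto intro!: monoI monoD)
  then have [measurable]: "(\<lambda>t. \<Omega> (max 0 t)) \<in> borel_measurable borel" by (rule borel_measurable_mono)
  have "(\<lambda>x. \<Omega> (max 0 (h x))) \<in> borel_measurable M"
    using measurable_compose[OF assms(1), of "\<lambda>t. \<Omega> (max 0 t)" borel] by simp
  then show ?thesis by (rule measurable_cong[THEN iffD1, rotated]) (simp add: assms(2) max_absorb2)
qed

end

section \<open>Consequences of the tail condition\<close>

lemma one_le_card: "1 \<le> real CARD('d::finite)"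
  by (simp add: Suc_le_eq)

lemma cube_tail_le:
  fixes c :: "real ^ 'd" and l :: real and v :: "real ^ 'd \<Rightarrow> real"
  assumes "l > 0" "0 < weight_measure v (cube c l)" "weight_measure v (cube c l) < \<infinity>"
  shows "(\<integral>\<^sup>+x\<in>- cube c l. ennreal (v x / norm (x - c) ^ CARD('d) * \<Omega> (l / norm (x - c))) \<partial>lebesgue)
      \<le> B_const \<Omega> v * weight_avg v (cube c l)" (is "?I \<le> _")
proof -
  let ?Q = "emeasure lebesgue (cube c l)" and ?v = "weight_measure v (cube c l)"
  have Q: "?Q \<noteq> 0" "?Q < top" using emeasure_cube_pos[OF assms(1), of c] emeasure_cube_fin[OF assms(1), of c] by auto
  have le: "?Q / ?v * ?I \<le> B_const \<Omega> v"
    unfolding B_const_def using assms(1) by (intro SUP_upper2[of c] SUP_upper2[of l]) auto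
  have "?I = (?Q / ?Q) * (?v / ?v) * ?I" using Q assms by simp
  also have "\<dots> = ?Q / ?v * ?I * (?v / ?Q)"
    unfolding divide_ennreal_def by (simp only: ac_simps)
  also have "\<dots> \<le> B_const \<Omega> v * (?v / ?Q)" by (intro mult_right_mono le) auto
  finally show ?thesis by (simp add: weight_avg_def)
qed

text \<open>
  On the dilate \<open>3 d Q\<close>, minus \<open>Q\<close>, the quotient \<open>l / |x - c|\<close> is at least \<open>1 / (3 d\<^sup>2)\<close>, so the tail integrand is at
  least \<open>v(x) / |Q|\<close> divided by this number.
\<close>

definition doubling_bound :: "(real \<Rightarrow> real) \<Rightarrow> nat \<Rightarrow> real" where
  "doubling_bound \<Omega> d = real (3 * d\<^sup>2) ^ d / \<Omega> (1 / real (3 * d\<^sup>2))"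

context modulus
begin

lemma doubling_bound_pos: "d > 0 \<Longrightarrow> doubling_bound \<Omega> d > 0"
  unfolding doubling_bound_def by (intro divide_pos_pos pos zero_less_power) auto

lemma shell_le:
  fixes c :: "real ^ 'd" and l :: real and v :: "real ^ 'd \<Rightarrow> real"
  assumes "l > 0" "0 < weight_measure v (cube c l)" "weight_measure v (cube c l) < \<infinity>"
    and [measurable]: "v \<in> borel_measurable lebesgue" and v: "AE x in lebesgue. 0 \<le> v x"
  shows "weight_measure v (cube c (3 * CARD('d) * l) - cube c l)
    \<le> ennreal (doubling_bound \<Omega> CARD('d)) * B_const \<Omega> v * weight_measure v (cube c l)"
proof -
  define k where "k = real (3 * CARD('d)\<^sup>2)"
  have k: "k > 0" by (simp add: k_def)
  let ?R = "cube c (3 * CARD('d) * l) - cube c l"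
  let ?h = "\<lambda>x. v x / norm (x - c) ^ CARD('d) * \<Omega> (l / norm (x - c))"
  have [measurable]: "(\<lambda>x. \<Omega> (l / norm (x - c))) \<in> borel_measurable lebesgue"
  proof (rule borel_measurable_comp)
    show "(\<lambda>x. l / norm (x - c)) \<in> borel_measurable lebesgue"
      by (intro measurable_completion) simp
  qed (use \<open>l > 0\<close> in auto)
  have [measurable]: "(\<lambda>x. norm (x - c) ^ CARD('d)) \<in> borel_measurable lebesgue"
    by (intro measurable_completion) simp
  define J where "J = doubling_bound \<Omega> CARD('d) * l ^ CARD('d)"
  have Jp: "J > 0" unfolding J_def using doubling_bound_pos[of "CARD('d)"] \<open>l > 0\<close> by simp
  have pw: "v x \<le> J * ?h x" if x: "x \<in> ?R" "0 \<le> v x" for x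
  proof -
    let ?r = "norm (x - c)"
    have "l / 2 \<le> ?r" using x by (intro norm_ge_off_cube) auto
    then have r0: "?r > 0" using \<open>l > 0\<close> by linarith
    have "?r \<le> CARD('d) * (3 * CARD('d) * l) / 2" using x by (intro norm_le_in_cube) auto
    also have "\<dots> \<le> k * l" using \<open>l > 0\<close> by (simp add: k_def power2_eq_square)
    finally have r: "?r \<le> k * l" .
    have "\<Omega> (1 / k) \<le> \<Omega> (l / ?r)"
      using r r0 k \<open>l > 0\<close> by (intro monoD) (auto simp: field_simps)
    moreover have "1 / (k * l) ^ CARD('d) \<le> 1 / ?r ^ CARD('d)"
      using r r0 k \<open>l > 0\<close> by (intro divide_left_mono power_mono mult_pos_pos zero_less_power) auto
    ultimately have "\<Omega> (1 / k) * (1 / (k * l) ^ CARD('d)) \<le> \<Omega> (l / ?r) * (1 / ?r ^ CARD('d))"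
      using nonneg[of "1 / k"] nonneg[of "l / ?r"] k \<open>l > 0\<close> by (intro mult_mono) auto
    then have le: "J * v x * (\<Omega> (1 / k) * (1 / (k * l) ^ CARD('d))) \<le> J * v x * (\<Omega> (l / ?r) * (1 / ?r ^ CARD('d)))"
      using Jp x by (intro mult_left_mono) auto
    have "J * (\<Omega> (1 / k) * (1 / (k * l) ^ CARD('d))) = 1"
    proof -
      have "doubling_bound \<Omega> CARD('d) = k ^ CARD('d) / \<Omega> (1 / k)"
        by (simp only: doubling_bound_def k_def)
      then show ?thesis
        using pos[of "1 / k"] k \<open>l > 0\<close> by (simp add: J_def power_mult_distrib)
    qed
    then have "v x = J * v x * (\<Omega> (1 / k) * (1 / (k * l) ^ CARD('d)))"
      by (metis mult.assoc mult.commute mult.right_neutral)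
    also note le
    also have "J * v x * (\<Omega> (l / ?r) * (1 / ?r ^ CARD('d))) = J * ?h x" by simp
    finally show ?thesis .
  qed
  have "weight_measure v ?R \<le> (\<integral>\<^sup>+x. ennreal J * (ennreal (?h x) * indicator (- cube c l) x) \<partial>lebesgue)"
    unfolding weight_measure_def
  proof (rule nn_integral_mono_AE, use v in eventually_elim)
    fix x assume "0 \<le> v x"
    then show "ennreal (v x) * indicator ?R x \<le> ennreal J * (ennreal (?h x) * indicator (- cube c l) x)"
      using pw[of x] Jp by (cases "x \<in> ?R") (auto simp: ennreal_leI simp flip: ennreal_mult')
  qed
  also have "\<dots> = ennreal J * (\<integral>\<^sup>+x\<in>- cube c l. ennreal (?h x) \<partial>lebesgue)"
    by (intro nn_integral_cmult) measurable
  also have "\<dots> \<le> ennreal J * (B_const \<Omega> v * weight_avg v (cube c l))"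
    by (intro mult_left_mono cube_tail_le assms) auto
  also have "ennreal J = ennreal (doubling_bound \<Omega> CARD('d)) * emeasure lebesgue (cube c l)"
    using \<open>l > 0\<close> doubling_bound_pos[of "CARD('d)"] by (simp add: J_def emeasure_cube ennreal_mult)
  also have "\<dots> * (B_const \<Omega> v * weight_avg v (cube c l)) = ennreal (doubling_bound \<Omega> CARD('d)) * B_const \<Omega> v *
      (weight_avg v (cube c l) * emeasure lebesgue (cube c l))"
    by (simp only: ac_simps)
  also have "weight_avg v (cube c l) * emeasure lebesgue (cube c l) = weight_measure v (cube c l)"
    using \<open>l > 0\<close> by (rule weight_avg_times_volume)
  finally show ?thesis .
qed

lemma weight_measure_one: "A \<in> sets lebesgue \<Longrightarrow> weight_measure (\<lambda>_. 1) A = emeasure lebesgue A"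
  by (simp add: weight_measure_def)

text \<open>
  The preceding estimate for the constant weight bounds the volume of a shell that is larger than
  the cube.  In the doubling estimate below, this lets the tail constant of the weight \<open>1\<close> pay for
  the mass of the cube itself.
\<close>

lemma one_le_B_const:
  "1 \<le> ennreal (doubling_bound \<Omega> CARD('d)) * B_const \<Omega> (\<lambda>_ :: real ^ 'd. 1)"
proof -
  let ?Q = "cube (0 :: real^'d) 1" and ?R = "cube (0 :: real^'d) (3 * CARD('d))"
  have Q: "emeasure lebesgue ?Q = 1" by (simp add: emeasure_cube)
  have sub: "?Q \<subseteq> ?R" by (intro cube_mono) (use one_le_card[where 'd='d] in linarith)
  have R: "emeasure lebesgue ?R = ennreal ((3 * CARD('d)) ^ CARD('d))" by (simp add: emeasure_cube)
  have "(2::real) \<le> 3 * CARD('d)" using one_le_card[where 'd='d] by linarith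
  also have "\<dots> \<le> (3 * CARD('d)) ^ CARD('d)"
    using power_increasing[of 1 "CARD('d)" "3 * real CARD('d)"] one_le_card[where 'd='d] by (simp add: Suc_le_eq)
  finally have "1 + 1 \<le> emeasure lebesgue ?R"
    unfolding R by (simp add: ennreal_leI flip: ennreal_numeral)
  also have "emeasure lebesgue ?R = emeasure lebesgue ?Q + emeasure lebesgue (?R - ?Q)"
    using sub by (subst plus_emeasure) (auto simp: Un_absorb1)
  finally have "1 \<le> emeasure lebesgue (?R - ?Q)" unfolding Q ennreal_add_left_cancel_le by simp
  also have "\<dots> = weight_measure (\<lambda>_. 1) (cube (0::real^'d) (3 * CARD('d) * 1) - ?Q)"
    by (subst weight_measure_one) auto
  also have "\<dots> \<le> ennreal (doubling_bound \<Omega> CARD('d)) * B_const \<Omega> (\<lambda>_ :: real ^ 'd. 1) * weight_measure (\<lambda>_. 1) ?Q"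
    using shell_le[where l=1 and c="0::real^'d" and v="\<lambda>_. 1"] by (simp add: weight_measure_one Q)
  finally show ?thesis by (simp add: weight_measure_one Q)
qed

lemma weight_measure_enlarged_cube_le:
  fixes c :: "real ^ 'd" and l :: real and v :: "real ^ 'd \<Rightarrow> real"
  assumes "l > 0" "0 < weight_measure v (cube c l)" "weight_measure v (cube c l) < \<infinity>"
    and [measurable]: "v \<in> borel_measurable lebesgue" and v: "AE x in lebesgue. 0 \<le> v x"
  shows "weight_measure v (cube c (3 * CARD('d) * l))
    \<le> ennreal (doubling_bound \<Omega> CARD('d)) * (B_const \<Omega> (\<lambda>_ :: real ^ 'd. 1) + B_const \<Omega> v) * weight_measure v (cube c l)"
proof -
  let ?Q = "cube c l" and ?R = "cube c (3 * CARD('d) * l)" and ?D = "ennreal (doubling_bound \<Omega> CARD('d))"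
  have "l \<le> 3 * CARD('d) * l" using \<open>l > 0\<close> one_le_card[where 'd='d] mult_right_mono[of 1 "3 * real CARD('d)" l] by linarith
  then have sub: "?Q \<subseteq> ?R" by (rule cube_mono)
  have "weight_measure v ?R = weight_measure v (?Q \<union> (?R - ?Q))" using sub by (simp add: Un_absorb1)
  also have "\<dots> = weight_measure v ?Q + weight_measure v (?R - ?Q)"
    unfolding weight_measure_def by (intro set_nn_integral_Un_disjoint) auto
  also have "\<dots> \<le> (?D * B_const \<Omega> (\<lambda>_ :: real ^ 'd. 1)) * weight_measure v ?Q + ?D * B_const \<Omega> v * weight_measure v ?Q"
    using mult_right_mono[OF one_le_B_const, of "weight_measure v ?Q"]
    by (intro add_mono shell_le assms) auto
  also have "\<dots> = ?D * (B_const \<Omega> (\<lambda>_ :: real ^ 'd. 1) + B_const \<Omega> v) * weight_measure v ?Q"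
    by (simp only: distrib_left distrib_right)
  finally show ?thesis .
qed

end

section \<open>Local oscillation of the singular integral\<close>

text \<open>
  The first summand comes from the weak-type bound for the part of \<open>f\<close> on \<open>3 d Q\<close>, the second from
  the smoothness of the kernel, applied to the rest of \<open>f\<close>.
\<close>

definition oscillation_bound :: "(real \<Rightarrow> real) \<Rightarrow> nat \<Rightarrow> real \<Rightarrow> real" where
  "oscillation_bound \<Omega> d N = 4 * 2 ^ d * N * doubling_bound \<Omega> d + real d"

lemma integrable_indicator_mult:
  fixes f :: "'a \<Rightarrow> complex"
  assumes "integrable M f" "A \<in> sets M"
  shows "integrable M (\<lambda>x. indicator A x * f x)"
proof -
  have "(\<lambda>x. indicator A x * f x) = (\<lambda>x. indicat_real A x *\<^sub>R f x)"
    by (auto simp: fun_eq_iff indicator_def)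
  then show ?thesis using integrable_mult_indicator[OF assms(2,1)] by simp
qed

context modulus
begin

text \<open>
  Off \<open>3 d Q\<close> the function \<open>f\<close> contributes to \<open>T f\<close>, on \<open>Q\<close>, a constant \<open>m\<close> up to an error that is bounded
  everywhere: the oscillation of the kernel is controlled by \<open>\<Omega>\<close> and its integral against \<open>v\<close> is the
  tail in \<^const>\<open>B_const\<close>.  The rest of \<open>f\<close> has mass at most a multiple of \<open>L v(Q)\<close> by the doubling estimate, and the
  weak-type bound limits the size of the set where its image is large.
\<close>

lemma local_oscillation_singular_integral:
  fixes T :: "(real ^ 'd \<Rightarrow> complex) \<Rightarrow> real ^ 'd \<Rightarrow> complex"
    and K :: "real ^ 'd \<Rightarrow> real ^ 'd \<Rightarrow> complex"
    and f :: "real ^ 'd \<Rightarrow> complex" and v :: "real ^ 'd \<Rightarrow> real" and c :: "real ^ 'd" and l L N :: real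
  assumes lin: "linear_on_L1 T"
    and N: "N > 0"
    and Tm: "\<And>f. integrable lebesgue f \<Longrightarrow> T f \<in> borel_measurable lebesgue"
    and weak: "\<And>f t. integrable lebesgue f \<Longrightarrow> t > 0 \<Longrightarrow>
       ennreal t * emeasure lebesgue {x. t < norm (T f x)} \<le> ennreal (N * (\<integral>x. norm (f x) \<partial>lebesgue))"
    and kern: "has_kernel T K"
    and smooth: "\<And>x y z. norm (x - y) > 2 * norm (x - z) \<Longrightarrow> 2 * norm (x - z) > 0 \<Longrightarrow>
           norm (K x y - K z y) \<le> \<Omega> (norm (x - z) / norm (x - y)) * (1 / norm (x - y) ^ CARD('d))"
    and f: "integrable lebesgue f" "compact (ess_support f)"
    and v [measurable]: "v \<in> borel_measurable lebesgue" and v0: "AE x in lebesgue. 0 \<le> v x"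
    and vfin: "0 < weight_measure v (cube c l)" "weight_measure v (cube c l) < \<infinity>"
    and L: "L > 0" and fv: "AE x in lebesgue. norm (f x) \<le> L * v x"
    and "l > 0"
    and Bfin: "B_const \<Omega> (\<lambda>_ :: real ^ 'd. 1) + B_const \<Omega> v < \<infinity>" (is "?B < _")
  shows "\<exists>m. 4 * 2 ^ CARD('d) * emeasure lebesgue {x \<in> cube c l.
      ennreal (oscillation_bound \<Omega> CARD('d) N * L) * ?B * weight_avg v (cube c l) < ennreal (norm (T f x - m))}
    \<le> emeasure lebesgue (cube c l)"
proof -
  let ?Q = "cube c l" and ?R = "cube c (3 * CARD('d) * l)" and ?d = "CARD('d)"
  let ?D = "doubling_bound \<Omega> ?d"
  have D: "?D > 0" by (rule doubling_bound_pos) simp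
  have fm [measurable]: "f \<in> borel_measurable lebesgue" using f by auto
  have d1: "1 \<le> real ?d" by (rule one_le_card)
  define f1 where "f1 x = indicator ?R x * f x" for x
  define f2 where "f2 x = indicator (- ?R) x * f x" for x
  have f1: "integrable lebesgue f1" and f2: "integrable lebesgue f2"
    unfolding f1_def f2_def by (auto intro!: integrable_indicator_mult f)
  have "(\<lambda>y. f1 y + f2 y) = f" by (auto simp: f1_def f2_def indicator_def)
  then have split: "AE x in lebesgue. T f x = T f1 x + T f2 x"
    using lin f1 f2 unfolding linear_on_L1_def by metis
  have "?B > 0"
  proof -
    have "B_const \<Omega> (\<lambda>_ :: real ^ 'd. 1) \<noteq> 0" using one_le_B_const[where 'd='d] by auto
    then show ?thesis by (auto simp: zero_less_iff_neq_zero)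
  qed
  then obtain b where b: "?B = ennreal b" "b > 0" using Bfin by (cases ?B) auto
  have "weight_avg v ?Q \<noteq> 0" "weight_avg v ?Q \<noteq> top"
    using vfin emeasure_cube_nz[OF \<open>l > 0\<close>, of c] emeasure_cube_nt[OF \<open>l > 0\<close>, of c]
    by (auto simp: weight_avg_def ennreal_divide_eq_top_iff)
  then obtain u where u: "weight_avg v ?Q = ennreal u" "u > 0" by (cases "weight_avg v ?Q") auto
  have vQ: "weight_measure v ?Q = ennreal (u * l ^ ?d)"
    using weight_avg_times_volume[OF \<open>l > 0\<close>, of v c] \<open>l > 0\<close> u by (simp add: emeasure_cube ennreal_mult)

  \<comment> \<open>The part of \<open>f\<close> near \<open>Q\<close>: the level \<open>t\<close> is chosen so that the weak-type bound equals
      \<open>|Q| / (4 2\<^sup>d)\<close>.\<close>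
  define t where "t = 4 * 2 ^ ?d * N * ?D * L * b * u"
  have t: "t > 0" using N D L b u by (simp add: t_def)
  have near: "4 * 2 ^ ?d * emeasure lebesgue {x. t < norm (T f1 x)} \<le> emeasure lebesgue ?Q"
  proof -
    have "ennreal (\<integral>x. norm (f1 x) \<partial>lebesgue) = (\<integral>\<^sup>+x. ennreal (norm (f1 x)) \<partial>lebesgue)"
      using f1 by (intro nn_integral_eq_integral[symmetric]) auto
    also have "\<dots> \<le> (\<integral>\<^sup>+x. ennreal L * (ennreal (v x) * indicator ?R x) \<partial>lebesgue)"
      by (rule nn_integral_mono_AE, use fv v0 in eventually_elim)
        (use L in \<open>auto simp: f1_def indicator_def ennreal_leI simp flip: ennreal_mult\<close>)
    also have "\<dots> = ennreal L * weight_measure v ?R"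
      unfolding weight_measure_def by (intro nn_integral_cmult) measurable
    also have "\<dots> \<le> ennreal L * (ennreal ?D * ?B * weight_measure v ?Q)"
      by (intro mult_left_mono weight_measure_enlarged_cube_le \<open>l > 0\<close> vfin v v0) auto
    also have "\<dots> = ennreal (L * (?D * b * (u * l ^ ?d)))"
      using L D b u \<open>l > 0\<close> by (simp add: vQ ennreal_mult)
    finally have I: "(\<integral>x. norm (f1 x) \<partial>lebesgue) \<le> L * (?D * b * (u * l ^ ?d))"
      using L D b u \<open>l > 0\<close> by (subst (asm) ennreal_le_iff) auto
    let ?e = "emeasure lebesgue {x. t < norm (T f1 x)}"
    have "ennreal t * ?e \<le> ennreal (N * (L * (?D * b * (u * l ^ ?d))))"
      using weak[OF f1 t] I N by (auto elim!: order_trans intro!: ennreal_leI)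
    then have "4 * 2 ^ ?d * (ennreal t * ?e) \<le> 4 * 2 ^ ?d * ennreal (N * (L * (?D * b * (u * l ^ ?d))))"
      by (intro mult_left_mono) auto
    also have "\<dots> = ennreal (4 * 2 ^ ?d) * ennreal (N * (L * (?D * b * (u * l ^ ?d))))"
      by (simp add: ennreal_mult flip: ennreal_power)
    also have "\<dots> = ennreal (t * l ^ ?d)"
      using N L D b u \<open>l > 0\<close> by (subst ennreal_mult[symmetric]) (auto simp: t_def ac_simps)
    also have "\<dots> = ennreal t * emeasure lebesgue ?Q"
      using t \<open>l > 0\<close> by (simp add: emeasure_cube ennreal_mult)
    finally have "ennreal t * (4 * 2 ^ ?d * ?e) \<le> ennreal t * emeasure lebesgue ?Q"
      by (simp only: ac_simps)
    then show ?thesis using t by (subst (asm) ennreal_mult_le_mult_iff) auto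
  qed

  define m where "m = (\<integral>y. K c y * f2 y \<partial>lebesgue)"
  have RQ: "?Q \<subseteq> ?R" and lR: "l < 3 * ?d * l"
  proof -
    show "l < 3 * ?d * l" using mult_right_mono[of 1 "real ?d" l] d1 \<open>l > 0\<close> by linarith
    then show "?Q \<subseteq> ?R" by (intro cube_mono) auto
  qed
  have off: "x \<notin> ess_support f2" if "x \<in> ?Q" for x
  proof (rule not_in_ess_supportI)
    let ?b = "box (\<chi> i. c $ i - 3 * ?d * l / 2) (\<chi> i. c $ i + 3 * ?d * l / 2)"
    show "open ?b" by (rule open_box)
    show "x \<in> ?b" unfolding mem_box_cart
    proof (intro allI)
      fix i
      have "c $ i - l / 2 \<le> x $ i" "x $ i < c $ i + l / 2" using that by (auto simp: cube_def)
      then show "(\<chi> i. c $ i - 3 * ?d * l / 2) $ i < x $ i \<and> x $ i < (\<chi> i. c $ i + 3 * ?d * l / 2) $ i"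
        using lR unfolding vec_lambda_beta by linarith
    qed
    show "f2 y = 0" if "y \<in> ?b" for y
      using that box_subset_cube[of c "3 * ?d * l"] by (auto simp: f2_def)
  qed
  have "ess_support f2 \<subseteq> ess_support f" by (rule ess_support_mono) (simp add: f2_def)
  then have "compact (ess_support f2)"
    using compact_Int_closed[OF f(2) closed_ess_support[of f2]] by (simp add: Int_absorb1)
  then have ki: "\<And>x. x \<in> ?Q \<Longrightarrow> integrable lebesgue (\<lambda>y. K x y * f2 y)"
    and kv: "AE x in lebesgue. x \<notin> ess_support f2 \<longrightarrow> T f2 x = (\<integral>y. K x y * f2 y \<partial>lebesgue)"
    using kern f2 off unfolding has_kernel_def by blast+
  let ?h = "\<lambda>y. v y / norm (y - c) ^ ?d * \<Omega> (l / norm (y - c))"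
  \<comment> \<open>\<open>|y - c| \<ge> 3 d l / 2\<close> exceeds \<open>d l \<ge> 2 |x - c|\<close>, as the smoothness condition demands.\<close>
  have kern_diff: "norm (K x y - K c y) \<le> ?d * (\<Omega> (l / norm (y - c)) / norm (y - c) ^ ?d)"
    if "x \<in> ?Q" "y \<notin> ?R" for x y
  proof -
    have y: "3 * ?d * l / 2 \<le> norm (y - c)" using that by (intro norm_ge_off_cube)
    have x: "norm (x - c) \<le> ?d * l / 2" using that by (intro norm_le_in_cube)
    have dl: "?d * l > 0" using \<open>l > 0\<close> by simp
    have r0: "norm (y - c) > 0" using y dl by linarith
    have O: "0 \<le> \<Omega> (l / norm (y - c))" using \<open>l > 0\<close> by (intro nonneg) auto
    show ?thesis
    proof (cases "x = c")
      case False
      have "norm (K c y - K x y) \<le> \<Omega> (norm (c - x) / norm (c - y)) * (1 / norm (c - y) ^ ?d)"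
        using x y dl False by (intro smooth) (auto simp: norm_minus_commute)
      also have "\<Omega> (norm (c - x) / norm (c - y)) \<le> \<Omega> (real ?d * (l / norm (y - c)))"
      proof (intro monoD)
        have "norm (c - x) \<le> ?d * l" using x dl by (simp add: norm_minus_commute)
        then show "norm (c - x) / norm (c - y) \<le> real ?d * (l / norm (y - c))"
          using r0 by (simp add: norm_minus_commute divide_right_mono)
      qed auto
      also have "\<dots> \<le> ?d * \<Omega> (l / norm (y - c))" using \<open>l > 0\<close> by (intro multiple_le) auto
      finally show ?thesis
        by (simp add: norm_minus_commute mult_right_mono divide_right_mono)
    qed (use O in auto)
  qed
  have far: "norm ((\<integral>y. K x y * f2 y \<partial>lebesgue) - m) \<le> ?d * L * b * u" if x: "x \<in> ?Q" for x
  proof -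
    have cQ: "c \<in> ?Q" using \<open>l > 0\<close> by (rule centre_in_cube)
    have "(\<integral>y. K x y * f2 y \<partial>lebesgue) - m = (\<integral>y. K x y * f2 y - K c y * f2 y \<partial>lebesgue)"
      unfolding m_def by (intro Bochner_Integration.integral_diff[symmetric] ki x cQ)
    then have "ennreal (norm ((\<integral>y. K x y * f2 y \<partial>lebesgue) - m))
        \<le> (\<integral>\<^sup>+y. ennreal (norm (K x y * f2 y - K c y * f2 y)) \<partial>lebesgue)"
      using integral_norm_bound_ennreal[OF Bochner_Integration.integrable_diff[OF ki[OF x] ki[OF cQ]]] by simp
    also have "\<dots> \<le> (\<integral>\<^sup>+y. ennreal (?d * L) * (ennreal (?h y) * indicator (- ?Q) y) \<partial>lebesgue)"
    proof (rule nn_integral_mono_AE, use fv v0 in eventually_elim)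
      case (elim y)
      show ?case
      proof (cases "y \<in> ?R")
        case False
        have "norm (K x y * f2 y - K c y * f2 y) = norm (K x y - K c y) * norm (f y)"
          using False by (simp add: f2_def norm_mult flip: left_diff_distrib)
        also have "\<dots> \<le> ?d * (\<Omega> (l / norm (y - c)) / norm (y - c) ^ ?d) * (L * v y)"
          by (intro mult_mono kern_diff x False elim) (use \<open>l > 0\<close> in \<open>auto intro!: divide_nonneg_nonneg mult_nonneg_nonneg nonneg\<close>)
        also have "\<dots> = ?d * L * ?h y" by (simp add: mult_ac)
        finally have "ennreal (norm (K x y * f2 y - K c y * f2 y)) \<le> ennreal (?d * L * ?h y)"
          by (rule ennreal_leI)
        also have "\<dots> = ennreal (?d * L) * ennreal (?h y)" using L by (intro ennreal_mult') simp
        also have "\<dots> = ennreal (?d * L) * (ennreal (?h y) * indicator (- ?Q) y)"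
          using False RQ by (auto simp: indicator_def)
        finally show ?thesis .
      qed (simp add: f2_def)
    qed
    also have "\<dots> = ennreal (?d * L) * (\<integral>\<^sup>+y\<in>- ?Q. ennreal (?h y) \<partial>lebesgue)"
    proof (rule nn_integral_cmult)
      have [measurable]: "(\<lambda>x. \<Omega> (l / norm (x - c))) \<in> borel_measurable lebesgue"
      proof (rule borel_measurable_comp)
        show "(\<lambda>x. l / norm (x - c)) \<in> borel_measurable lebesgue"
          by (intro measurable_completion) simp
      qed (use \<open>l > 0\<close> in auto)
      have [measurable]: "(\<lambda>x. norm (x - c) ^ ?d) \<in> borel_measurable lebesgue"
        by (intro measurable_completion) simp
      show "(\<lambda>y. ennreal (?h y) * indicator (- ?Q) y) \<in> borel_measurable lebesgue" by measurable
    qed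
    also have "\<dots> \<le> ennreal (?d * L) * (B_const \<Omega> v * weight_avg v ?Q)"
      by (intro mult_left_mono cube_tail_le \<open>l > 0\<close> vfin) auto
    also have "\<dots> \<le> ennreal (?d * L) * (?B * weight_avg v ?Q)"
      by (intro mult_left_mono mult_right_mono) (auto intro: add_increasing)
    also have "\<dots> = ennreal (?d * L * b * u)"
      using L b u by (simp add: ennreal_mult mult.assoc)
    finally show ?thesis using L b u by (subst (asm) ennreal_le_iff) auto
  qed

  have lev: "ennreal (oscillation_bound \<Omega> ?d N * L) * ?B * weight_avg v ?Q = ennreal (t + ?d * L * b * u)"
  proof -
    have "oscillation_bound \<Omega> ?d N > 0" using N D by (simp add: oscillation_bound_def add_pos_pos)
    then have "ennreal (oscillation_bound \<Omega> ?d N * L) * ?B * weight_avg v ?Q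
        = ennreal (oscillation_bound \<Omega> ?d N * L * b * u)"
      using L b u by (simp add: ennreal_mult)
    then show ?thesis by (simp add: t_def oscillation_bound_def algebra_simps)
  qed
  have "emeasure lebesgue {x \<in> ?Q. ennreal (t + ?d * L * b * u) < ennreal (norm (T f x - m))}
      \<le> emeasure lebesgue {x. t < norm (T f1 x)}"
  proof (rule emeasure_mono_AE)
    have "{x \<in> space lebesgue. t < norm (T f1 x)} \<in> sets lebesgue"
      using Tm[OF f1] by measurable
    then show "{x. t < norm (T f1 x)} \<in> sets lebesgue" by simp
    show "AE x in lebesgue. x \<in> {x \<in> ?Q. ennreal (t + ?d * L * b * u) < ennreal (norm (T f x - m))} \<longrightarrow>
        x \<in> {x. t < norm (T f1 x)}"
      using split kv
    proof eventually_elim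
      case (elim x)
      show ?case
      proof clarsimp
        assume x: "x \<in> ?Q" and lt: "ennreal (t + ?d * L * b * u) < ennreal (norm (T f x - m))"
        have "T f2 x = (\<integral>y. K x y * f2 y \<partial>lebesgue)" using elim off[OF x] by blast
        then have "norm (T f2 x - m) \<le> ?d * L * b * u" using far[OF x] by simp
        moreover have "norm (T f x - m) \<le> norm (T f1 x) + norm (T f2 x - m)"
          using elim norm_triangle_ineq[of "T f1 x" "T f2 x - m"] by (simp add: algebra_simps)
        moreover have "t + ?d * L * b * u < norm (T f x - m)"
          using lt t L b u by (subst (asm) ennreal_less_iff) auto
        ultimately show "t < norm (T f1 x)" by linarith
      qed
    qed
  qed
  then have "4 * 2 ^ ?d * emeasure lebesgue {x \<in> ?Q. ennreal (t + ?d * L * b * u) < ennreal (norm (T f x - m))}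
     \<le> emeasure lebesgue ?Q"
    using near by (meson mult_left_mono order_trans zero_le)
  then show ?thesis unfolding lev by blast
qed

end

section \<open>The tail constant of an A1 weight\<close>

lemma AE_le_Linf_norm:
  assumes [measurable]: "E \<in> sets lebesgue"
  shows "AE x in lebesgue. x \<in> E \<longrightarrow> ennreal (norm (g x)) \<le> Linf_norm E g"
  using esssup_AE[of "\<lambda>x. ennreal (norm (g x))" "lebesgue_on E"]
  unfolding Linf_norm_def by (subst (asm) AE_restrict_space_iff) auto

lemma Linf_norm_leI:
  fixes g :: "real ^ 'd \<Rightarrow> real"
  assumes [measurable]: "E \<in> sets lebesgue" "g \<in> borel_measurable lebesgue"
    and "AE x in lebesgue. x \<in> E \<longrightarrow> ennreal (norm (g x)) \<le> s"
  shows "Linf_norm E g \<le> s"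
  unfolding Linf_norm_def
proof (rule esssup_I)
  show "(\<lambda>x. ennreal (norm (g x))) \<in> borel_measurable (lebesgue_on E)"
    by (intro measurable_restrict_space1) measurable
  show "AE x in lebesgue_on E. ennreal (norm (g x)) \<le> s"
    using assms(3) by (subst AE_restrict_space_iff) auto
qed

lemma Linf_norm_mono:
  fixes g :: "real ^ 'd \<Rightarrow> real"
  assumes "A \<subseteq> B" "A \<in> sets lebesgue" "B \<in> sets lebesgue" "g \<in> borel_measurable lebesgue"
  shows "Linf_norm A g \<le> Linf_norm B g"
proof (rule Linf_norm_leI[OF assms(2,4)])
  show "AE x in lebesgue. x \<in> A \<longrightarrow> ennreal (norm (g x)) \<le> Linf_norm B g"
    using AE_le_Linf_norm[OF assms(3), of g] by eventually_elim (use assms(1) in blast)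
qed

lemma A1_const_ge:
  "l > 0 \<Longrightarrow> weight_avg v (cube c l) * Linf_norm (cube c l) (\<lambda>x. inverse (v x)) \<le> A1_const v"
  unfolding A1_const_def by (intro SUP_upper2[of c] SUP_upper2[of l]) auto

text \<open>The average of \<open>v\<close> is at least its essential infimum.\<close>

lemma one_le_A1_ratio:
  fixes v :: "real ^ 'd \<Rightarrow> real"
  assumes "l > 0" and [measurable]: "v \<in> borel_measurable lebesgue" and v: "AE x in lebesgue. 0 < v x"
  shows "1 \<le> weight_avg v (cube c l) * Linf_norm (cube c l) (\<lambda>x. inverse (v x))"
proof -
  let ?Q = "cube c l" and ?s = "Linf_norm (cube c l) (\<lambda>x. inverse (v x))"
  have "emeasure lebesgue ?Q = (\<integral>\<^sup>+x. indicator ?Q x \<partial>lebesgue)" by simp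
  also have "\<dots> \<le> (\<integral>\<^sup>+x. (ennreal (v x) * indicator ?Q x) * ?s \<partial>lebesgue)"
  proof (rule nn_integral_mono_AE, use v AE_le_Linf_norm[OF cube_lebesgue, of c l "\<lambda>x. inverse (v x)"] in eventually_elim)
    case (elim x)
    show ?case
    proof (cases "x \<in> ?Q")
      case True
      have "1 = ennreal (v x) * ennreal (norm (inverse (v x)))"
        using elim by (simp flip: ennreal_mult)
      also have "\<dots> \<le> ennreal (v x) * ?s" using elim True by (intro mult_left_mono) auto
      finally show ?thesis using True by simp
    qed simp
  qed
  also have "\<dots> = weight_measure v ?Q * ?s"
    unfolding weight_measure_def by (intro nn_integral_multc) measurable
  finally have "emeasure lebesgue ?Q / emeasure lebesgue ?Q \<le> weight_measure v ?Q * ?s / emeasure lebesgue ?Q"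
    by (rule divide_right_mono_ennreal)
  also have "\<dots> = weight_avg v ?Q * ?s"
    by (simp add: weight_avg_def divide_ennreal_def ac_simps)
  finally show ?thesis
    using emeasure_cube_nz[OF \<open>l > 0\<close>, of c] emeasure_cube_fin[OF \<open>l > 0\<close>, of c] by simp
qed

lemma one_le_A1_const:
  fixes v :: "real ^ 'd \<Rightarrow> real"
  assumes "v \<in> borel_measurable lebesgue" "AE x in lebesgue. 0 < v x"
  shows "1 \<le> A1_const v"
  using one_le_A1_ratio[of 1 v 0] A1_const_ge[of 1 v 0] assms by (auto elim: order_trans)

lemma A1_const_one: "A1_const (\<lambda>_ :: real ^ 'd. 1) \<le> 1"
  unfolding A1_const_def
proof (intro SUP_least)
  fix c :: "real ^ 'd" and l :: real assume "l \<in> {0<..}"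
  then have l: "l > 0" by simp
  have "weight_avg (\<lambda>_. 1) (cube c l) = 1"
    using l by (simp add: weight_avg_def weight_measure_def emeasure_cube)
  moreover have "Linf_norm (cube c l) (\<lambda>x. inverse (1::real)) \<le> 1" by (intro Linf_norm_leI) auto
  ultimately show "weight_avg (\<lambda>_. 1) (cube c l) * Linf_norm (cube c l) (\<lambda>x. inverse (1::real)) \<le> 1" by simp
qed

text \<open>
  The essential infimum of \<open>v\<close> only decreases when the cube grows, and up to the \<open>A\<^sub>1\<close> constant
  it is the average.
\<close>

lemma weight_avg_le_A1_const:
  fixes v :: "real ^ 'd \<Rightarrow> real"
  assumes "0 < l" "l \<le> l'" and v: "v \<in> borel_measurable lebesgue" "AE x in lebesgue. 0 < v x"
  shows "weight_avg v (cube c l') \<le> A1_const v * weight_avg v (cube c l)"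
proof -
  let ?L = "\<lambda>l. Linf_norm (cube c l) (\<lambda>x. inverse (v x))"
  have "weight_avg v (cube c l') * 1 \<le> weight_avg v (cube c l') * (weight_avg v (cube c l) * ?L l)"
    by (intro mult_left_mono one_le_A1_ratio assms) auto
  also have "\<dots> \<le> weight_avg v (cube c l') * (weight_avg v (cube c l) * ?L l')"
    using v by (intro mult_left_mono Linf_norm_mono cube_mono assms) auto
  also have "\<dots> = (weight_avg v (cube c l') * ?L l') * weight_avg v (cube c l)" by (simp only: ac_simps)
  also have "\<dots> \<le> A1_const v * weight_avg v (cube c l)"
    using assms by (intro mult_right_mono A1_const_ge) auto
  finally show ?thesis by simp
qed

lemma emeasure_lebesgue_Ioo: "a \<le> b \<Longrightarrow> emeasure lebesgue {a<..<b::real} = ennreal (b - a)"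
  by (simp add: emeasure_completion)

context modulus
begin

text \<open>On \<open>2\<^sup>-\<^sup>k\<^sup>-\<^sup>1 < t < 2\<^sup>-\<^sup>k\<close> the integrand is at least \<open>2\<^sup>k \<Omega>(2\<^sup>-\<^sup>k\<^sup>-\<^sup>1)\<close>.\<close>

lemma dyadic_sum_le_Dini: "(\<Sum>k. ennreal (\<Omega> (1 / 2 ^ Suc k))) \<le> 2 * Dini_norm \<Omega>"
proof -
  define J where "J k = {1 / 2 ^ Suc k<..<1 / 2 ^ k :: real}" for k
  define h where "h t = ennreal (\<Omega> (max 0 t) / t)" for t :: real
  have "(\<lambda>t::real. \<Omega> (max 0 t)) \<in> borel_measurable lebesgue"
    by (rule borel_measurable_comp) (auto intro: measurable_completion)
  then have [measurable]: "h \<in> borel_measurable lebesgue"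
    unfolding h_def by (intro measurable_compose[OF _ measurable_ennreal] borel_measurable_divide) (auto intro: measurable_completion)
  have Jm [measurable]: "J k \<in> sets lebesgue" for k by (simp add: J_def)
  have disj: "disjoint_family J"
    unfolding disjoint_family_on_def
  proof (intro ballI impI)
    have *: "J k \<inter> J k' = {}" if "k < k'" for k k'
    proof -
      have "(2::real) ^ Suc k \<le> 2 ^ k'" using that by (intro power_increasing) auto
      then have "1 / 2 ^ k' \<le> 1 / (2 ^ Suc k :: real)" by (intro divide_left_mono) auto
      then show ?thesis unfolding J_def by fastforce
    qed
    fix k k' :: nat assume "k \<noteq> k'"
    then show "J k \<inter> J k' = {}" using *[of k k'] *[of k' k] by (cases "k < k'") auto
  qed
  have "ennreal (\<Omega> (1 / 2 ^ Suc k)) \<le> 2 * (\<integral>\<^sup>+t\<in>J k. h t \<partial>lebesgue)" for k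
  proof -
    define a :: real where "a = 1 / 2 ^ Suc k"
    have a: "a > 0" and Jk: "J k = {a<..<2 * a}" by (auto simp: a_def J_def)
    have "emeasure lebesgue (J k) = ennreal (2 * a - a)"
      unfolding Jk using a by (intro emeasure_lebesgue_Ioo) linarith
    then have "emeasure lebesgue (J k) = ennreal a" by simp
    moreover have "2 * (ennreal (\<Omega> a / (2 * a)) * ennreal a) = ennreal (\<Omega> a)"
    proof -
      have "ennreal (\<Omega> a / (2 * a)) * ennreal a = ennreal (\<Omega> a / 2)"
        using a nonneg[of a] by (subst ennreal_mult[symmetric]) auto
      then show ?thesis using a nonneg[of a] by (simp add: numeral_mult_ennreal)
    qed
    ultimately have "ennreal (\<Omega> a) = 2 * (\<integral>\<^sup>+t\<in>J k. ennreal (\<Omega> a / (2 * a)) \<partial>lebesgue)"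
      by (simp add: nn_integral_cmult_indicator)
    also have "\<dots> \<le> 2 * (\<integral>\<^sup>+t\<in>J k. h t \<partial>lebesgue)"
    proof (intro mult_left_mono nn_integral_mono)
      fix t
      have "ennreal (\<Omega> a / (2 * a)) \<le> h t" if "t \<in> J k"
      proof -
        have t: "a < t" "t < 2 * a" using that unfolding Jk by auto
        then have "\<Omega> a / (2 * a) \<le> \<Omega> t / t"
          using a nonneg[of a] nonneg[of t] t by (intro frac_le monoD) auto
        then show ?thesis using t a unfolding h_def by (simp add: ennreal_leI max_def)
      qed
      then show "ennreal (\<Omega> a / (2 * a)) * indicator (J k) t \<le> h t * indicator (J k) t"
        by (simp add: indicator_def)
    qed auto
    finally show ?thesis unfolding a_def .
  qed
  then have "(\<Sum>k. ennreal (\<Omega> (1 / 2 ^ Suc k))) \<le> (\<Sum>k. 2 * (\<integral>\<^sup>+t\<in>J k. h t \<partial>lebesgue))"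
    by (intro suminf_le) auto
  also have "\<dots> = 2 * (\<integral>\<^sup>+k. (\<integral>\<^sup>+t\<in>J k. h t \<partial>lebesgue) \<partial>count_space UNIV)"
    by (simp add: nn_integral_count_space_nat)
  also have "(\<integral>\<^sup>+k. (\<integral>\<^sup>+t\<in>J k. h t \<partial>lebesgue) \<partial>count_space UNIV) = (\<integral>\<^sup>+t\<in>(\<Union>k. J k). h t \<partial>lebesgue)"
    using disj by (intro nn_integral_UN_countable[symmetric]) auto
  also have "\<dots> \<le> Dini_norm \<Omega>"
    unfolding Dini_norm_def
  proof (rule nn_integral_mono)
    fix t
    have J01: "t \<in> {0<..<1}" if "t \<in> J k" for k
    proof -
      have "1 / 2 ^ k \<le> (1::real)" "0 < (1::real) / 2 ^ Suc k" by auto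
      then show ?thesis
        using that unfolding J_def greaterThanLessThan_iff by linarith
    qed
    show "h t * indicator (\<Union>k. J k) t \<le> ennreal (\<Omega> t / t) * indicator {0<..<1} t"
    proof (cases "t \<in> (\<Union>k. J k)")
      case True
      then have "t \<in> {0<..<1}" using J01 by blast
      then show ?thesis using True by (simp add: h_def max_def)
    qed simp
  qed
  finally show ?thesis by (simp add: mult_left_mono)
qed

text \<open>
  Decompose the complement of \<open>Q\<close> into dyadic annuli.  On the \<open>k\<close>-th one the kernel is, up to a constant,
  at most \<open>\<Omega>(2\<^sup>-\<^sup>k) / |2\<^sup>k Q|\<close>, and the average of \<open>v\<close> over \<open>2\<^sup>k Q\<close> is controlled by that over \<open>Q\<close>.
\<close>

lemma B_const_le_Dini:
  fixes v :: "real ^ 'd \<Rightarrow> real"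
  assumes v [measurable]: "v \<in> borel_measurable lebesgue" and v0: "AE x in lebesgue. 0 < v x"
    and vfin: "\<And>c l. l > 0 \<Longrightarrow> 0 < weight_measure v (cube c l)"
       "\<And>c l. l > 0 \<Longrightarrow> weight_measure v (cube c l) < \<infinity>"
  shows "B_const \<Omega> v \<le> ennreal (8 * 4 ^ CARD('d)) * A1_const v * Dini_norm \<Omega>"
  unfolding B_const_def
proof (intro SUP_least)
  fix c :: "real ^ 'd" and l :: real assume "l \<in> {0<..}"
  then have l: "l > 0" by simp
  let ?d = "CARD('d)" and ?Q = "cube c l"
  let ?h = "\<lambda>x. v x / norm (x - c) ^ ?d * \<Omega> (l / norm (x - c))"
  define R where "R k = cube c (2 ^ Suc k * l)" for k
  define a where "a k = 4 * \<Omega> (1 / 2 ^ Suc k) / (2 ^ k * l / 2) ^ ?d" for k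
  have a0: "a k \<ge> 0" for k unfolding a_def using nonneg l by (intro divide_nonneg_nonneg) auto
  \<comment> \<open>\<open>R k\<close> is the first of the growing cubes that contains \<open>x\<close>, so \<open>x\<close> is off the cube of half its size;
      summing over the full cubes \<open>R k\<close> instead of annuli costs nothing.\<close>
  have pw: "\<exists>k. x \<in> R k \<and> ?h x \<le> a k * v x" if x: "x \<notin> ?Q" and vx: "0 < v x" for x
  proof -
    let ?r = "norm (x - c)"
    obtain n where n: "2 * ?r / l < 2 ^ n" using real_arch_pow[of 2 "2 * ?r / l"] by auto
    have ex: "\<exists>j. x \<in> cube c (2 ^ j * l)"
      using norm_ge_off_cube[of x c "2 ^ n * l"] n l by (intro exI[of _ n]) (auto simp: field_simps)
    define j where "j = (LEAST j. x \<in> cube c (2 ^ j * l))"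
    have j: "x \<in> cube c (2 ^ j * l)" unfolding j_def using ex by (rule LeastI_ex)
    have "j \<noteq> 0" using j x by (cases j) auto
    then obtain k where k: "j = Suc k" by (cases j) auto
    have "x \<notin> cube c (2 ^ k * l)" using not_less_Least[of k "\<lambda>j. x \<in> cube c (2 ^ j * l)"] k unfolding j_def by simp
    then have r: "2 ^ k * l / 2 \<le> ?r" by (rule norm_ge_off_cube)
    have p: "2 ^ k * l / 2 > 0" using l by simp
    have "\<Omega> (l / ?r) \<le> \<Omega> (real 4 * (1 / 2 ^ Suc k))"
    proof (rule monoD)
      have "0 < ?r" using r p by linarith
      then have "l / ?r \<le> l / (2 ^ k * l / 2)" using r p l by (intro divide_left_mono mult_pos_pos) auto
      also have "\<dots> = real 4 * (1 / 2 ^ Suc k)" using l by simp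
      finally show "l / ?r \<le> real 4 * (1 / 2 ^ Suc k)" .
    qed (use l in simp)
    also have "\<dots> \<le> real 4 * \<Omega> (1 / 2 ^ Suc k)" by (intro multiple_le) simp
    finally have O: "\<Omega> (l / ?r) \<le> 4 * \<Omega> (1 / 2 ^ Suc k)" by simp
    have "1 / ?r ^ ?d \<le> 1 / (2 ^ k * l / 2) ^ ?d"
      using r p by (intro divide_left_mono power_mono mult_pos_pos zero_less_power) auto
    then have "(1 / ?r ^ ?d) * \<Omega> (l / ?r) \<le> (1 / (2 ^ k * l / 2) ^ ?d) * (4 * \<Omega> (1 / 2 ^ Suc k))"
      using O nonneg[of "l / ?r"] p l by (intro mult_mono) auto
    then have "v x * ((1 / ?r ^ ?d) * \<Omega> (l / ?r)) \<le> v x * a k"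
      using vx by (intro mult_left_mono) (auto simp: a_def)
    then show ?thesis using j k by (intro exI[of _ k]) (auto simp: R_def mult.commute)
  qed
  have "(\<integral>\<^sup>+x\<in>- ?Q. ennreal (?h x) \<partial>lebesgue)
      \<le> (\<integral>\<^sup>+x. (\<Sum>k. ennreal (a k) * (ennreal (v x) * indicator (R k) x)) \<partial>lebesgue)"
  proof (rule nn_integral_mono_AE, use v0 in eventually_elim)
    case (elim x)
    show ?case
    proof (cases "x \<in> ?Q")
      case False
      then obtain k where k: "x \<in> R k" "?h x \<le> a k * v x" using pw elim by blast
      have "ennreal (?h x) \<le> ennreal (a k) * (ennreal (v x) * indicator (R k) x)"
        using k a0[of k] by (simp add: ennreal_leI flip: ennreal_mult')
      also have "\<dots> = (\<Sum>j\<in>{k}. ennreal (a j) * (ennreal (v x) * indicator (R j) x))" by simp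
      also have "\<dots> \<le> (\<Sum>k. ennreal (a k) * (ennreal (v x) * indicator (R k) x))"
        by (intro sum_le_suminf) auto
      finally show ?thesis using False by simp
    qed simp
  qed
  also have "\<dots> = (\<Sum>k. ennreal (a k) * weight_measure v (R k))"
    unfolding weight_measure_def R_def
    by (subst nn_integral_suminf) (auto simp: nn_integral_cmult)
  also have "\<dots> \<le> (\<Sum>k. ennreal (4 * 4 ^ ?d) * (A1_const v * weight_avg v ?Q) * ennreal (\<Omega> (1 / 2 ^ Suc k)))"
  proof (intro suminf_le)
    fix k
    have lk: "0 < 2 ^ Suc k * l" "l \<le> 2 ^ Suc k * l"
      using l mult_right_mono[of 1 "2 ^ Suc k" l] one_le_power[of "2::real" "Suc k"] by auto
    have "ennreal (a k) * weight_measure v (R k) = ennreal (a k) * emeasure lebesgue (R k) * weight_avg v (R k)"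
      unfolding R_def weight_avg_times_volume[OF lk(1), of v c, symmetric] by (simp only: ac_simps)
    also have "ennreal (a k) * emeasure lebesgue (R k) = ennreal (a k * (2 ^ Suc k * l) ^ ?d)"
      unfolding R_def emeasure_cube[OF lk(1)] by (rule ennreal_mult'[symmetric, OF a0])
    also have "a k * (2 ^ Suc k * l) ^ ?d = 4 * 4 ^ ?d * \<Omega> (1 / 2 ^ Suc k)"
    proof -
      have "2 ^ Suc k * l = 4 * (2 ^ k * l / 2)" by simp
      then have "(2 ^ Suc k * l) ^ ?d = 4 ^ ?d * (2 ^ k * l / 2) ^ ?d" by (simp only: power_mult_distrib)
      moreover have "(2 ^ k * l / 2) ^ ?d \<noteq> 0" using l by simp
      ultimately show ?thesis unfolding a_def by simp
    qed
    also have "ennreal (4 * 4 ^ ?d * \<Omega> (1 / 2 ^ Suc k)) * weight_avg v (R k)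
       \<le> ennreal (4 * 4 ^ ?d * \<Omega> (1 / 2 ^ Suc k)) * (A1_const v * weight_avg v ?Q)"
      unfolding R_def by (intro mult_left_mono weight_avg_le_A1_const l lk v v0) auto
    also have "ennreal (4 * 4 ^ ?d * \<Omega> (1 / 2 ^ Suc k)) = ennreal (4 * 4 ^ ?d) * ennreal (\<Omega> (1 / 2 ^ Suc k))"
      by (rule ennreal_mult') simp
    finally show "ennreal (a k) * weight_measure v (R k)
        \<le> ennreal (4 * 4 ^ ?d) * (A1_const v * weight_avg v ?Q) * ennreal (\<Omega> (1 / 2 ^ Suc k))"
      by (simp only: ac_simps)
  qed auto
  also have "\<dots> = ennreal (4 * 4 ^ ?d) * (A1_const v * weight_avg v ?Q) * (\<Sum>k. ennreal (\<Omega> (1 / 2 ^ Suc k)))"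
    by (rule ennreal_suminf_cmult)
  also have "\<dots> \<le> ennreal (4 * 4 ^ ?d) * (A1_const v * weight_avg v ?Q) * (2 * Dini_norm \<Omega>)"
    by (intro mult_left_mono dyadic_sum_le_Dini) auto
  also have "\<dots> = ennreal (8 * 4 ^ ?d) * A1_const v * Dini_norm \<Omega> * weight_avg v ?Q"
  proof -
    have "ennreal (8 * 4 ^ ?d) = ennreal (4 * 4 ^ ?d) * 2"
      by (simp add: mult.commute[of _ 2] numeral_mult_ennreal)
    then show ?thesis by (simp only: ac_simps)
  qed
  finally have I: "(\<integral>\<^sup>+x\<in>- ?Q. ennreal (?h x) \<partial>lebesgue)
      \<le> ennreal (8 * 4 ^ ?d) * A1_const v * Dini_norm \<Omega> * weight_avg v ?Q" .
  have "emeasure lebesgue ?Q / weight_measure v ?Q * (\<integral>\<^sup>+x\<in>- ?Q. ennreal (?h x) \<partial>lebesgue)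
      \<le> emeasure lebesgue ?Q / weight_measure v ?Q * (ennreal (8 * 4 ^ ?d) * A1_const v * Dini_norm \<Omega> * weight_avg v ?Q)"
    by (intro mult_left_mono I) auto
  also have "\<dots> = ennreal (8 * 4 ^ ?d) * A1_const v * Dini_norm \<Omega> *
     ((emeasure lebesgue ?Q / emeasure lebesgue ?Q) * (weight_measure v ?Q / weight_measure v ?Q))"
    unfolding weight_avg_def divide_ennreal_def by (simp only: ac_simps)
  also have "\<dots> = ennreal (8 * 4 ^ ?d) * A1_const v * Dini_norm \<Omega>"
    using emeasure_cube_nz[OF l, of c] emeasure_cube_fin[OF l, of c] vfin[OF l, of c] by simp
  finally show "emeasure lebesgue ?Q / weight_measure v ?Q * (\<integral>\<^sup>+x\<in>- ?Q. ennreal (?h x) \<partial>lebesgue)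
      \<le> ennreal (8 * 4 ^ ?d) * A1_const v * Dini_norm \<Omega>" .
qed

end

section \<open>Weighted estimates for the singular integral\<close>

text \<open>The average of \<open>g\<close> approximates \<open>g\<close> as well as any other constant, up to a factor two.\<close>

lemma mean_osc_le:
  fixes g :: "real ^ 'd \<Rightarrow> complex"
  assumes [measurable]: "g \<in> borel_measurable lebesgue" and l: "l > 0"
  shows "mean_osc g (cube c l) \<le> 2 * (\<integral>\<^sup>+x\<in>cube c l. ennreal (norm (g x - m)) \<partial>lebesgue) / emeasure lebesgue (cube c l)"
    (is "_ \<le> 2 * ?X / ?\<mu>")
proof (cases "?X = top")
  case True
  then show ?thesis using l by (simp add: emeasure_cube ennreal_mult_top ennreal_top_divide)
next
  case False
  let ?Q = "cube c l"
  have X: "(\<integral>\<^sup>+x. ennreal (norm (indicat_real ?Q x *\<^sub>R (g x - m))) \<partial>lebesgue) = ?X"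
    by (intro nn_integral_cong) (simp add: indicator_def)
  have Im: "set_integrable lebesgue ?Q (\<lambda>x. g x - m)"
    unfolding set_integrable_def using False X by (intro integrableI_bounded) (auto simp: less_top)
  have Ic: "set_integrable lebesgue ?Q (\<lambda>x. m)"
    unfolding set_integrable_def using emeasure_cube_fin[OF l, of c] by (intro integrable_scaleR_left integrable_real_indicator) auto
  have mu: "measure lebesgue ?Q > 0" "?\<mu> = ennreal (measure lebesgue ?Q)"
    using l by (auto simp: measure_def emeasure_cube)
  have "set_integrable lebesgue ?Q (\<lambda>x. (g x - m) + m)" by (intro set_integral_add Im Ic)
  then have Ig: "set_integrable lebesgue ?Q g" by simp
  have "(LINT x:?Q|lebesgue. g x - m) = (LINT x:?Q|lebesgue. g x) - (LINT x:?Q|lebesgue. m)"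
    by (intro set_integral_diff Ig Ic)
  also have "(LINT x:?Q|lebesgue. m) = measure lebesgue ?Q *\<^sub>R m"
    using emeasure_cube_fin[OF l, of c] unfolding set_lebesgue_integral_def by simp
  finally have "measure lebesgue ?Q *\<^sub>R (avg g ?Q - m) = (LINT x:?Q|lebesgue. g x - m)"
    using mu by (simp add: avg_def scaleR_diff_right)
  then have "measure lebesgue ?Q * norm (avg g ?Q - m) = norm (LINT x:?Q|lebesgue. g x - m)"
    by (metis mu(1) abs_of_pos norm_scaleR)
  then have "?\<mu> * ennreal (norm (avg g ?Q - m)) = ennreal (norm (LINT x:?Q|lebesgue. g x - m))"
    using mu by (simp flip: ennreal_mult)
  also have "\<dots> \<le> ?X"
    using integral_norm_bound_ennreal[OF Im[unfolded set_integrable_def]] unfolding X set_lebesgue_integral_def .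
  finally have av: "?\<mu> * ennreal (norm (avg g ?Q - m)) \<le> ?X" .
  have "(\<integral>\<^sup>+x\<in>?Q. ennreal (norm (g x - avg g ?Q)) \<partial>lebesgue)
     \<le> (\<integral>\<^sup>+x. ennreal (norm (g x - m)) * indicator ?Q x + ennreal (norm (avg g ?Q - m)) * indicator ?Q x \<partial>lebesgue)"
    using ennreal_norm_triangle[of "g _" "avg g ?Q" m]
    by (intro nn_integral_mono) (auto simp: indicator_def norm_minus_commute)
  also have "\<dots> = ?X + ennreal (norm (avg g ?Q - m)) * ?\<mu>"
    by (subst nn_integral_add) (auto simp: nn_integral_cmult_indicator)
  also have "\<dots> \<le> ?X + ?X" using av by (intro add_mono) (auto simp: mult.commute)
  finally show ?thesis unfolding mean_osc_def mult_2 by (rule divide_right_mono_ennreal)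
qed

lemma maximal_integral_le_Ainf:
  assumes "l > 0" "0 < weight_measure v (cube c l)" "weight_measure v (cube c l) < \<infinity>"
  shows "(\<integral>\<^sup>+x\<in>cube c l. maximal_op (\<lambda>y. indicat_real (cube c l) y * v y) x \<partial>lebesgue)
    \<le> Ainf_const v * weight_measure v (cube c l)" (is "?I \<le> _")
proof -
  let ?v = "weight_measure v (cube c l)"
  have "?I = ?I / ?v * ?v" using assms by (simp add: ennreal_divide_times)
  also have "\<dots> \<le> Ainf_const v * ?v"
    unfolding Ainf_const_def using assms(1)
    by (intro mult_right_mono SUP_upper2[of c] SUP_upper2[of l]) auto
  finally show ?thesis .
qed

text \<open>
  Positivity makes the right-hand side of the estimate below infinite whenever a tail constant is,
  instead of a product of infinity and zero.
\<close>

lemma Ainf_const_pos: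
  assumes "l > 0" "0 < weight_measure v (cube c l)" "weight_measure v (cube c l) < \<infinity>"
  shows "0 < Ainf_const v"
proof -
  let ?I = "(\<integral>\<^sup>+x\<in>cube c l. maximal_op (\<lambda>y. indicat_real (cube c l) y * v y) x \<partial>lebesgue)"
  have "weight_measure v (cube c l) = (\<integral>\<^sup>+x\<in>cube c l. weight_avg v (cube c l) \<partial>lebesgue)"
    using weight_avg_times_volume[OF assms(1), of v c] by (simp add: nn_integral_cmult_indicator)
  also have "\<dots> \<le> ?I"
    using weight_avg_le_maximal_op[OF assms(1)] by (intro nn_integral_mono) (auto simp: indicator_def)
  also have "\<dots> \<le> Ainf_const v * weight_measure v (cube c l)" by (rule maximal_integral_le_Ainf[OF assms])
  finally show ?thesis using assms(2) by (auto simp: zero_less_iff_neq_zero)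
qed

context modulus
begin

text \<open>
  The local oscillation is at most a multiple of the average of \<open>v\<close>, so the passage from local to
  mean oscillation produces the integral of the maximal function of \<open>v\<close> restricted to \<open>Q\<close>, which the
  \<open>A\<^sub>\<infinity>\<close> constant compares with \<open>v(Q)\<close>.
\<close>

lemma mean_osc_singular_integral_le:
  fixes T :: "(real ^ 'd \<Rightarrow> complex) \<Rightarrow> real ^ 'd \<Rightarrow> complex"
    and K :: "real ^ 'd \<Rightarrow> real ^ 'd \<Rightarrow> complex"
    and f :: "real ^ 'd \<Rightarrow> complex" and v :: "real ^ 'd \<Rightarrow> real" and c :: "real ^ 'd" and l L N :: real
  assumes lin: "linear_on_L1 T"
    and N: "N > 0"
    and Tm: "\<And>f. integrable lebesgue f \<Longrightarrow> T f \<in> borel_measurable lebesgue"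
    and weak: "\<And>f t. integrable lebesgue f \<Longrightarrow> t > 0 \<Longrightarrow>
       ennreal t * emeasure lebesgue {x. t < norm (T f x)} \<le> ennreal (N * (\<integral>x. norm (f x) \<partial>lebesgue))"
    and kern: "has_kernel T K"
    and smooth: "\<And>x y z. norm (x - y) > 2 * norm (x - z) \<Longrightarrow> 2 * norm (x - z) > 0 \<Longrightarrow>
           norm (K x y - K z y) \<le> \<Omega> (norm (x - z) / norm (x - y)) * (1 / norm (x - y) ^ CARD('d))"
    and f: "integrable lebesgue f" "compact (ess_support f)"
    and v [measurable]: "v \<in> borel_measurable lebesgue" and v0: "AE x in lebesgue. 0 \<le> v x"
    and vfin: "\<And>c l. l > 0 \<Longrightarrow> 0 < weight_measure v (cube c l)"
       "\<And>c l. l > 0 \<Longrightarrow> weight_measure v (cube c l) < \<infinity>"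
    and L: "L \<ge> 0" and fv: "AE x in lebesgue. norm (f x) \<le> L * v x"
    and l: "l > 0"
  shows "mean_osc (T f) (cube c l) \<le> ennreal (8 * oscillation_bound \<Omega> CARD('d) N) *
     (B_const \<Omega> (\<lambda>_ :: real ^ 'd. 1) + B_const \<Omega> v) * Ainf_const v * weight_avg v (cube c l) * ennreal L"
    (is "_ \<le> ennreal (8 * ?A) * ?B * _ * _ * _")
proof -
  let ?Q = "cube c l"
  have A: "?A > 0" using N doubling_bound_pos[of "CARD('d)"] by (simp add: oscillation_bound_def add_pos_pos)
  have Tf [measurable]: "T f \<in> borel_measurable lebesgue" by (rule Tm[OF f(1)])
  consider "L = 0" | "L > 0" "?B = top" | "L > 0" "?B < top" using L by (metis less_eq_real_def top.not_eq_extremum)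
  then show ?thesis
  proof cases
    case 1
    \<comment> \<open>Now \<open>f = 0\<close>, and the weak-type bound gives \<open>T f = 0\<close>.\<close>
    have "(\<integral>x. norm (f x) \<partial>lebesgue) = 0"
      using fv 1 by (intro integral_eq_zero_AE) (auto elim: AE_mp)
    then have z: "emeasure lebesgue {x. t < norm (T f x)} = 0" if "t > 0" for t
      using weak[OF f(1) that] that by simp
    have "AE x in lebesgue. \<forall>n. \<not> 1 / real (Suc n) < norm (T f x)"
    proof (subst AE_all_countable, intro allI)
      fix n
      have "{x \<in> space lebesgue. 1 / real (Suc n) < norm (T f x)} \<in> sets lebesgue" by measurable
      then have "{x. 1 / real (Suc n) < norm (T f x)} \<in> null_sets lebesgue"
        using z[of "1 / real (Suc n)"] by (auto simp: null_sets_def)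
      then show "AE x in lebesgue. \<not> 1 / real (Suc n) < norm (T f x)" by (drule_tac AE_not_in) simp
    qed
    then have "AE x in lebesgue. T f x = 0"
    proof eventually_elim
      case (elim x)
      show ?case
      proof (rule ccontr)
        assume "T f x \<noteq> 0"
        then obtain n where "inverse (real (Suc n)) < norm (T f x)"
          using reals_Archimedean[of "norm (T f x)"] by auto
        then show False using elim by (auto simp: inverse_eq_divide)
      qed
    qed
    then have "(\<integral>\<^sup>+x\<in>?Q. ennreal (norm (T f x - 0)) \<partial>lebesgue) = 0"
      by (subst nn_integral_0_iff_AE) (auto elim: AE_mp)
    then show ?thesis using mean_osc_le[OF Tf l, of c 0] by simp
  next
    case 2
    have "weight_avg v ?Q > 0"
      using vfin(1)[OF l, of c] emeasure_cube_nt[OF l, of c]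
      by (auto simp: weight_avg_def ennreal_zero_less_divide less_top)
    moreover have "Ainf_const v > 0" using vfin by (intro Ainf_const_pos[OF l]) (auto simp: l)
    ultimately have "ennreal (8 * ?A) * ?B * Ainf_const v * weight_avg v ?Q * ennreal L = top"
      unfolding 2(2) using 2(1) A by (simp add: ennreal_mult_top ennreal_top_mult zero_less_iff_neq_zero)
    then show ?thesis by simp
  next
    case 3
    let ?a = "ennreal (?A * L) * ?B"
    have "\<exists>m. (\<integral>\<^sup>+x\<in>?Q. ennreal (norm (T f x - m)) \<partial>lebesgue)
        \<le> 4 * ?a * (\<integral>\<^sup>+x\<in>?Q. maximal_op (\<lambda>y. indicat_real ?Q y * v y) x \<partial>lebesgue)"
    proof (rule oscillation_le_maximal_op[OF Tf _ l])
      fix c' :: "real ^ 'd" and l' :: real assume l': "l' > 0"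
      show "\<exists>m. 4 * 2 ^ CARD('d) * emeasure lebesgue {x \<in> cube c' l'. ?a * weight_avg v (cube c' l') < ennreal (norm (T f x - m))}
        \<le> emeasure lebesgue (cube c' l')"
        by (rule local_oscillation_singular_integral[OF lin N Tm weak kern smooth f v v0 vfin(1)[OF l'] vfin(2)[OF l'] 3(1) fv l'])
          (use 3(2) in auto)
    qed
    then obtain m where m: "(\<integral>\<^sup>+x\<in>?Q. ennreal (norm (T f x - m)) \<partial>lebesgue)
        \<le> 4 * ?a * (\<integral>\<^sup>+x\<in>?Q. maximal_op (\<lambda>y. indicat_real ?Q y * v y) x \<partial>lebesgue)" by blast
    have "mean_osc (T f) ?Q \<le> 2 * (\<integral>\<^sup>+x\<in>?Q. ennreal (norm (T f x - m)) \<partial>lebesgue) / emeasure lebesgue ?Q"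
      by (rule mean_osc_le[OF Tf l])
    also have "\<dots> \<le> 2 * (4 * ?a * (Ainf_const v * weight_measure v ?Q)) / emeasure lebesgue ?Q"
      using maximal_integral_le_Ainf[OF l vfin(1)[OF l] vfin(2)[OF l], of c]
      by (intro divide_right_mono_ennreal mult_left_mono order_trans[OF m]) auto
    also have "\<dots> = (2 * 4 * ennreal (?A * L)) * ?B * Ainf_const v * weight_avg v ?Q"
      unfolding weight_avg_def divide_ennreal_def by (simp only: ac_simps)
    also have "2 * 4 * ennreal (?A * L) = ennreal (8 * ?A) * ennreal L"
      using A L by (simp add: numeral_mult_ennreal flip: ennreal_mult)
    also have "ennreal (8 * ?A) * ennreal L * ?B * Ainf_const v * weight_avg v ?Q
        = ennreal (8 * ?A) * ?B * Ainf_const v * weight_avg v ?Q * ennreal L"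
      by (simp only: ac_simps)
    finally show ?thesis .
  qed
qed

end

lemma weight_measure_inverse_weight:
  fixes w :: "real ^ 'd \<Rightarrow> real"
  assumes w: "weight w" and int: "\<And>S. compact S \<Longrightarrow> set_integrable lebesgue S (\<lambda>x. inverse (w x))" and l: "l > 0"
  shows "0 < weight_measure (\<lambda>x. inverse (w x)) (cube c l)" "weight_measure (\<lambda>x. inverse (w x)) (cube c l) < \<infinity>"
proof -
  have [measurable]: "w \<in> borel_measurable lebesgue" and w0: "AE x in lebesgue. 0 < w x"
    using w by (auto simp: weight_def)
  let ?S = "cbox (\<chi> i. c $ i - l / 2) (\<chi> i. c $ i + l / 2)"
  have I: "integrable lebesgue (\<lambda>x. indicat_real ?S x *\<^sub>R inverse (w x))"
    using int[of ?S] by (simp add: set_integrable_def)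
  have "weight_measure (\<lambda>x. inverse (w x)) (cube c l)
      \<le> (\<integral>\<^sup>+x. ennreal (norm (indicat_real ?S x *\<^sub>R inverse (w x))) \<partial>lebesgue)"
    unfolding weight_measure_def using cube_subset_cbox[of c l]
    by (intro nn_integral_mono) (auto simp: indicator_def intro!: ennreal_leI simp flip: abs_inverse)
  also have "\<dots> < \<infinity>" using I by (simp add: integrable_iff_bounded)
  finally show "weight_measure (\<lambda>x. inverse (w x)) (cube c l) < \<infinity>" .
  have "weight_measure (\<lambda>x. inverse (w x)) (cube c l) \<noteq> 0"
  proof
    assume "weight_measure (\<lambda>x. inverse (w x)) (cube c l) = 0"
    then have "AE x in lebesgue. ennreal (inverse (w x)) * indicator (cube c l) x = 0"
      unfolding weight_measure_def by (subst (asm) nn_integral_0_iff_AE) auto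
    with w0 have "AE x in lebesgue. x \<notin> cube c l"
      by eventually_elim (auto simp: indicator_def ennreal_eq_0_iff split: if_splits)
    then have "emeasure lebesgue (cube c l) = 0"
      by (subst (asm) AE_iff_measurable[of "cube c l"]) auto
    then show False using emeasure_cube_nz[OF l] by blast
  qed
  then show "0 < weight_measure (\<lambda>x. inverse (w x)) (cube c l)" by (simp add: zero_less_iff_neq_zero)
qed

lemma integrable_of_weighted_bound:
  fixes w :: "real ^ 'd \<Rightarrow> real" and f :: "real ^ 'd \<Rightarrow> complex"
  assumes w: "AE x in lebesgue. 0 < w x"
    and int: "\<And>S. compact S \<Longrightarrow> set_integrable lebesgue S (\<lambda>x. inverse (w x))"
    and f: "f \<in> borel_measurable lebesgue" "compact (ess_support f)"
    and bd: "AE x in lebesgue. norm (f x) \<le> L * inverse (w x)"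
  shows "integrable lebesgue f"
proof (rule Bochner_Integration.integrable_bound)
  show "integrable lebesgue (\<lambda>x. L * (indicat_real (ess_support f) x *\<^sub>R inverse (w x)))"
    using int[OF f(2)] by (simp add: set_integrable_def)
  show "AE x in lebesgue. norm (f x) \<le> norm (L * (indicat_real (ess_support f) x *\<^sub>R inverse (w x)))"
    using bd AE_zero_off_ess_support[of f]
  proof eventually_elim
    case (elim x)
    then show ?case by (cases "x \<in> ess_support f") auto
  qed
qed (rule f)

theorem theoremB:
  fixes T :: "(real ^ 'd \<Rightarrow> complex) \<Rightarrow> real ^ 'd \<Rightarrow> complex"
    and K :: "real ^ 'd \<Rightarrow> real ^ 'd \<Rightarrow> complex"
    and \<Omega> :: "real \<Rightarrow> real"
  assumes "linear_on_L1 T"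
    and "weak_type_1_1 T"
    and "has_kernel T K"
    and "\<And>x y z. norm (x - y) > 2 * norm (x - z) \<Longrightarrow> 2 * norm (x - z) > 0 \<Longrightarrow>
           norm (K x y - K z y) \<le> \<Omega> (norm (x - z) / norm (x - y)) * (1 / norm (x - y) ^ CARD('d))"
    and "\<And>t. 0 \<le> t \<Longrightarrow> 0 \<le> \<Omega> t"
    and "mono_on {0..} \<Omega>"
    and "\<And>s t. 0 \<le> s \<Longrightarrow> 0 \<le> t \<Longrightarrow> \<Omega> (s + t) \<le> \<Omega> s + \<Omega> t"
    and "\<Omega> 0 = 0"
    and "\<exists>t\<ge>0. \<Omega> t \<noteq> 0"
  shows "\<exists>C::real. C > 0 \<and>
    (\<forall>(w :: real ^ 'd \<Rightarrow> real) (f :: real ^ 'd \<Rightarrow> complex) (c :: real ^ 'd) (l :: real).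
       weight w \<longrightarrow>
       (\<forall>S. compact S \<longrightarrow> set_integrable lebesgue S (\<lambda>x. inverse (w x))) \<longrightarrow>
       f \<in> borel_measurable lebesgue \<longrightarrow>
       compact (ess_support f) \<longrightarrow>
       Linf_norm UNIV (\<lambda>x. w x *\<^sub>R f x) < \<infinity> \<longrightarrow>
       l > 0 \<longrightarrow>
         mean_osc (T f) (cube c l)
           \<le> ennreal C * (B_const \<Omega> (\<lambda>x :: real ^ 'd. 1) + B_const \<Omega> (\<lambda>x. inverse (w x)))
               * Ainf_const (\<lambda>x. inverse (w x))
               * weight_avg (\<lambda>x. inverse (w x)) (cube c l)
               * Linf_norm UNIV (\<lambda>x. w x *\<^sub>R f x)
         \<and>
         Linf_norm (cube c l) w * mean_osc (T f) (cube c l)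
           \<le> ennreal C * (A1_const (\<lambda>x. inverse (w x)))\<^sup>2
               * Ainf_const (\<lambda>x. inverse (w x))
               * Dini_norm \<Omega>
               * Linf_norm UNIV (\<lambda>x. w x *\<^sub>R f x))"
proof -
  interpret modulus \<Omega> using assms(5-9) by unfold_locales auto
  obtain N0 where N0: "N0 \<ge> 0" and weak0: "\<And>f. integrable lebesgue f \<Longrightarrow>
      T f \<in> borel_measurable lebesgue \<and> (\<forall>t>0. ennreal t * emeasure lebesgue {x. t < norm (T f x)}
           \<le> ennreal (N0 * (\<integral>x. norm (f x) \<partial>lebesgue)))"
    using assms(2) unfolding weak_type_1_1_def by blast
  \<comment> \<open>The weak-type constant may be zero, the level in the local estimate must be positive.\<close>
  define N where "N = N0 + 1"
  have N: "N > 0" using N0 by (simp add: N_def)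
  have Tm: "T f \<in> borel_measurable lebesgue" if "integrable lebesgue f" for f
    using weak0[OF that] by blast
  have weak: "ennreal t * emeasure lebesgue {x. t < norm (T f x)} \<le> ennreal (N * (\<integral>x. norm (f x) \<partial>lebesgue))"
    if "integrable lebesgue f" "t > 0" for f t
  proof -
    have "ennreal t * emeasure lebesgue {x. t < norm (T f x)} \<le> ennreal (N0 * (\<integral>x. norm (f x) \<partial>lebesgue))"
      using weak0[OF that(1)] that(2) by blast
    also have "\<dots> \<le> ennreal (N * (\<integral>x. norm (f x) \<partial>lebesgue))"
      by (intro ennreal_leI mult_right_mono) (auto simp: N_def)
    finally show ?thesis .
  qed
  define A where "A = 8 * oscillation_bound \<Omega> CARD('d) N"
  have A: "A > 0" using N doubling_bound_pos[of "CARD('d)"] by (simp add: A_def oscillation_bound_def add_pos_pos)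
  \<comment> \<open>Both tail constants obey the Dini bound with the \<open>A\<^sub>1\<close> constant of \<open>w\<^sup>-\<^sup>1\<close>, since that of the weight
      \<open>1\<close> is at most \<open>1\<close>; hence the factor \<open>2\<close>.\<close>
  define D :: real where "D = 2 * (8 * 4 ^ CARD('d))"
  have D1: "D \<ge> 1" using one_le_power[of "4::real" "CARD('d)"] unfolding D_def by linarith
  define C where "C = A * D"
  have C: "C > 0" "A \<le> C" using A D1 by (auto simp: C_def intro: mult_pos_pos)
  have main: "mean_osc (T f) (cube c l)
           \<le> ennreal C * (B_const \<Omega> (\<lambda>x :: real ^ 'd. 1) + B_const \<Omega> (\<lambda>x. inverse (w x)))
               * Ainf_const (\<lambda>x. inverse (w x))
               * weight_avg (\<lambda>x. inverse (w x)) (cube c l)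
               * Linf_norm UNIV (\<lambda>x. w x *\<^sub>R f x)
         \<and>
         Linf_norm (cube c l) w * mean_osc (T f) (cube c l)
           \<le> ennreal C * (A1_const (\<lambda>x. inverse (w x)))\<^sup>2
               * Ainf_const (\<lambda>x. inverse (w x))
               * Dini_norm \<Omega>
               * Linf_norm UNIV (\<lambda>x. w x *\<^sub>R f x)"
    if w: "weight w" and int: "\<And>S. compact S \<Longrightarrow> set_integrable lebesgue S (\<lambda>x. inverse (w x))"
      and f: "f \<in> borel_measurable lebesgue" "compact (ess_support f)"
      and Lfin: "Linf_norm UNIV (\<lambda>x. w x *\<^sub>R f x) < \<infinity>" and l: "l > 0"
    for w :: "real ^ 'd \<Rightarrow> real" and f :: "real ^ 'd \<Rightarrow> complex" and c :: "real ^ 'd" and l :: real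
  proof -
    let ?v = "\<lambda>x. inverse (w x)" and ?Q = "cube c l"
    have [measurable]: "w \<in> borel_measurable lebesgue" and w0: "AE x in lebesgue. 0 < w x"
      using w by (auto simp: weight_def)
    have vm: "?v \<in> borel_measurable lebesgue" by measurable
    have v0: "AE x in lebesgue. 0 < ?v x" using w0 by eventually_elim simp
    have v0': "AE x in lebesgue. 0 \<le> ?v x" using w0 by eventually_elim simp
    note vfin = weight_measure_inverse_weight[OF w int]
    obtain L where L: "Linf_norm UNIV (\<lambda>x. w x *\<^sub>R f x) = ennreal L" "L \<ge> 0"
      using Lfin by (cases "Linf_norm UNIV (\<lambda>x. w x *\<^sub>R f x)") auto
    have UNIV_m: "(UNIV :: (real ^ 'd) set) \<in> sets lebesgue" by simp
    have fv: "AE x in lebesgue. norm (f x) \<le> L * ?v x"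
      using w0 AE_le_Linf_norm[of UNIV "\<lambda>x. w x *\<^sub>R f x", unfolded L(1), OF UNIV_m]
    proof eventually_elim
      case (elim x)
      then have "w x * norm (f x) \<le> L" using L(2) by (simp add: ennreal_le_iff)
      then show ?case using elim by (simp add: field_simps)
    qed
    have fi: "integrable lebesgue f" by (rule integrable_of_weighted_bound[OF w0 int f fv])
    let ?B = "B_const \<Omega> (\<lambda>x :: real ^ 'd. 1) + B_const \<Omega> ?v"
    have osc: "mean_osc (T f) ?Q \<le> ennreal A * ?B * Ainf_const ?v * weight_avg ?v ?Q * ennreal L"
      unfolding A_def
      by (rule mean_osc_singular_integral_le[OF assms(1) N Tm weak assms(3,4) fi f(2) vm v0' vfin L(2) fv l])
    have "ennreal A * ?B * Ainf_const ?v * weight_avg ?v ?Q * ennreal L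
        \<le> ennreal C * ?B * Ainf_const ?v * weight_avg ?v ?Q * ennreal L"
      using C by (intro mult_right_mono ennreal_leI) auto
    with osc have first: "mean_osc (T f) ?Q \<le> ennreal C * ?B * Ainf_const ?v * weight_avg ?v ?Q * ennreal L"
      by (rule order_trans)
    let ?E = "ennreal (8 * 4 ^ CARD('d))"
    have "B_const \<Omega> (\<lambda>x :: real ^ 'd. 1) \<le> ?E * A1_const (\<lambda>x :: real ^ 'd. 1) * Dini_norm \<Omega>"
      by (rule B_const_le_Dini) (auto simp: weight_measure_one emeasure_cube)
    also have "\<dots> \<le> ?E * A1_const ?v * Dini_norm \<Omega>"
      using A1_const_one one_le_A1_const[OF vm v0]
      by (intro mult_right_mono mult_left_mono) (auto elim: order_trans)
    finally have "?B \<le> ?E * A1_const ?v * Dini_norm \<Omega> + ?E * A1_const ?v * Dini_norm \<Omega>"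
      by (intro add_mono B_const_le_Dini vm v0 vfin) auto
    also have "\<dots> = (?E + ?E) * A1_const ?v * Dini_norm \<Omega>" by (simp only: distrib_right)
    also have "?E + ?E = ennreal D" by (simp add: D_def flip: ennreal_plus)
    finally have B: "?B \<le> ennreal D * A1_const ?v * Dini_norm \<Omega>" .
    have A1: "weight_avg ?v ?Q * Linf_norm ?Q w \<le> A1_const ?v"
      using A1_const_ge[OF l, of ?v c] by simp
    have "Linf_norm ?Q w * mean_osc (T f) ?Q
        \<le> Linf_norm ?Q w * (ennreal A * ?B * Ainf_const ?v * weight_avg ?v ?Q * ennreal L)"
      by (intro mult_left_mono osc) auto
    also have "\<dots> = ennreal A * ?B * Ainf_const ?v * (weight_avg ?v ?Q * Linf_norm ?Q w) * ennreal L"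
      by (simp only: ac_simps)
    also have "\<dots> \<le> ennreal A * (ennreal D * A1_const ?v * Dini_norm \<Omega>) * Ainf_const ?v * A1_const ?v * ennreal L"
      by (intro mult_right_mono mult_mono B A1) auto
    also have "\<dots> = (ennreal A * ennreal D) * (A1_const ?v)\<^sup>2 * Ainf_const ?v * Dini_norm \<Omega> * ennreal L"
      by (simp only: ac_simps power2_eq_square)
    also have "ennreal A * ennreal D = ennreal C"
      using A D1 by (simp add: C_def ennreal_mult)
    finally show ?thesis using first unfolding L(1) by blast
  qed
  show ?thesis using C(1) main by blast
qed

end
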